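(* Let $k\geq 3$, $n\geq 1$, $\ell\geq 1$. Let $G$ be a generator signature of arity $n$ on domain size $k$ of full rank, with $\mathrm{rank}\,G(t)=k$ for some $1\leq t\leq n$. Let $M$ be a $2^{\ell}\times k$ complex matrix of rank $k$ such that $\underline{G}=M^{\otimes n}G$ is the standard signature of a generator matchgate (of arity $n\ell$). Then the matrix $\underline{G}(t)$ has a $4\times 4$ submatrix of rank $4$.
   Context: A matchgate is a planar graph $H$ with complex edge weights together with designated output nodes on the outer face (labelled in counterclockwise order); a generator matchgate has only output nodes. Its standard signature is the vector $\underline{G}\in\mathbb{C}^{2^{m}}$ ($m$ the number of output nodes) whose entry indexed by $i_{1}\cdots i_{m}\in\{0,1\}^{m}$ (lexicographic order) is the sum over perfect matchings of $H-Z$ of the product of edge weights, where $Z$ is the set of output nodes $j$ with $i_{j}=1$. A generator signature of arity $n$ on domain size $k$ is $G=(G^{j_{1}\cdots j_{n}})\in\mathbb{C}^{k^{n}}$; $G(t)$ is the $k\times k^{n-1}$ matrix with rows indexed by $j_{t}$ and columns by $j_{1}\cdots j_{t-1}j_{t+1}\cdots j_{n}$ lexicographically. $G$ is degenerate if $G=\gamma_{1}\otimes\cdots\otimes\gamma_{n}$ with $\gamma_{i}\in\mathbb{C}^{k}$, and of full rank if not degenerate and $\mathrm{rank}\,G(t)=k$ for some $t$. A vector $\underline{G}\in\mathbb{C}^{2^{n\ell}}$ is regarded as having indices $\alpha_{1}\alpha_{2}\cdots\alpha_{n}$ with blocks $\alpha_{i}\in\{0,1\}^{\ell}$; $\underline{G}(t)$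 is the $2^{\ell}\times 2^{(n-1)\ell}$ matrix with rows indexed by $\alpha_{t}$ and columns by $\alpha_{1}\cdots\alpha_{t-1}\alpha_{t+1}\cdots\alpha_{n}$ (lexicographically). *)

theory Defs
  imports "HOL-Analysis.Analysis" "Jordan_Normal_Form.DL_Rank_Submatrix"
begin

unbundle no vec_syntax


section \<open>Lexicographically indexed tensors\<close>

text \<open>
  A tensor of arity \<open>n\<close> on domain size \<open>b\<close> is a vector of dimension \<open>b ^ n\<close>.  Its
  coordinates are labelled by the words \<open>j\<^sub>1 \<dots> j\<^sub>n\<close> over \<open>{0..<b}\<close> in
  lexicographic order, so that a word is the list of base \<open>b\<close> digits of its position, most
  significant digit first.  The two functions below convert between positions and words.
\<close>

definition index_word :: "nat \<Rightarrow> nat \<Rightarrow> nat \<Rightarrow> nat list" where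
  "index_word b n x = map (\<lambda>s. x div b ^ (n - 1 - s) mod b) [0..<n]"

definition word_index :: "nat \<Rightarrow> nat list \<Rightarrow> nat" where
  "word_index b w = horner_sum id b (rev w)"

text \<open>
  The matrix \<open>G(t)\<close> for \<open>1 \<le> t \<le> n\<close>: row \<open>j\<^sub>t\<close>, column
  \<open>j\<^sub>1 \<dots> j\<^sub>t\<^sub>-\<^sub>1 j\<^sub>t\<^sub>+\<^sub>1 \<dots> j\<^sub>n\<close>.  A vector of dimension
  \<open>2 ^ (n * l)\<close> is at the same time a tensor of arity \<open>n\<close> on domain size
  \<open>2 ^ l\<close>: its binary index word of length \<open>n * l\<close> is cut into \<open>n\<close> consecutive
  blocks of length \<open>l\<close>, and the lexicographic orders agree.  The block version of \<open>G(t)\<close>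
  is therefore \<open>flattening (2 ^ l) n t\<close>.
\<close>

definition flattening :: "nat \<Rightarrow> nat \<Rightarrow> nat \<Rightarrow> complex Matrix.vec \<Rightarrow> complex Matrix.mat" where
  "flattening b n t G = Matrix.mat b (b ^ (n - 1))
     (\<lambda>(j, c). let w = index_word b (n - 1) c
               in G $ word_index b (take (t - 1) w @ [j] @ drop (t - 1) w))"

definition tensor_of_vecs :: "nat \<Rightarrow> complex Matrix.vec list \<Rightarrow> complex Matrix.vec" where
  "tensor_of_vecs b gs = Matrix.vec (b ^ length gs)
     (\<lambda>x. \<Prod>s<length gs. gs ! s $ (index_word b (length gs) x ! s))"

definition tensor_power :: "nat \<Rightarrow> complex Matrix.mat \<Rightarrow> complex Matrix.mat" where
  "tensor_power n M = Matrix.mat (dim_row M ^ n) (dim_col M ^ n)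
     (\<lambda>(x, y). \<Prod>s<n. M $$ (index_word (dim_row M) n x ! s, index_word (dim_col M) n y ! s))"

definition degenerate :: "nat \<Rightarrow> nat \<Rightarrow> complex Matrix.vec \<Rightarrow> bool" where
  "degenerate b n G \<longleftrightarrow>
     (\<exists>gs. length gs = n \<and> set gs \<subseteq> carrier_vec b \<and> G = tensor_of_vecs b gs)"

definition full_rank :: "nat \<Rightarrow> nat \<Rightarrow> complex Matrix.vec \<Rightarrow> bool" where
  "full_rank b n G \<longleftrightarrow>
     \<not> degenerate b n G \<and> (\<exists>t\<in>{1..n}. vec_space.rank b (flattening b n t G) = b)"


section \<open>Matchgates\<close>

text \<open>
  A matchgate that has only output nodes.  The list \<open>outputs\<close> gives the output nodes in the
  order of their labels.
\<close>

record 'v gate =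
  nodes :: "'v set"
  edges :: "'v set set"
  weight :: "'v set \<Rightarrow> complex"
  outputs :: "'v list"

definition wf_gate :: "'v gate \<Rightarrow> bool" where
  "wf_gate H \<longleftrightarrow> finite (nodes H) \<and> edges H \<subseteq> {e. e \<subseteq> nodes H \<and> card e = 2} \<and>
     distinct (outputs H) \<and> set (outputs H) \<subseteq> nodes H"

definition drawing_set :: "'v gate \<Rightarrow> ('v \<Rightarrow> complex) \<Rightarrow> ('v set \<Rightarrow> real \<Rightarrow> complex) \<Rightarrow> complex set" where
  "drawing_set H p c = p ` nodes H \<union> (\<Union>e\<in>edges H. path_image (c e))"

definition plane_drawing :: "'v gate \<Rightarrow> ('v \<Rightarrow> complex) \<Rightarrow> ('v set \<Rightarrow> real \<Rightarrow> complex) \<Rightarrow> bool" where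
  "plane_drawing H p c \<longleftrightarrow> inj_on p (nodes H) \<and>
     (\<forall>e\<in>edges H. arc (c e) \<and> {pathstart (c e), pathfinish (c e)} = p ` e \<and>
        path_image (c e) \<inter> p ` nodes H = p ` e) \<and>
     (\<forall>e\<in>edges H. \<forall>e'\<in>edges H. e \<noteq> e' \<longrightarrow> path_image (c e) \<inter> path_image (c e') \<subseteq> p ` nodes H)"

text \<open>
  The outer face of a drawing is the unbounded component of its complement, that is,
  \<^term>\<open>outside\<close> of the drawing.  To say that the output nodes on its boundary are labelled
  in counterclockwise order, they are joined, by pairwise disjoint arcs through the outer face, to
  points of a circle around the drawing; the order is the one in which these points occur on the
  circle.  This also covers disconnected graphs and cut vertices, for which the boundary of the
  outer face is not a simple closed curve.
\<close>

definition outputs_ccw_on_outer_face ::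
    "'v gate \<Rightarrow> ('v \<Rightarrow> complex) \<Rightarrow> ('v set \<Rightarrow> real \<Rightarrow> complex) \<Rightarrow> bool" where
  "outputs_ccw_on_outer_face H p c \<longleftrightarrow>
     (let D = drawing_set H p c; m = length (outputs H); q = (\<lambda>i. p (outputs H ! i)) in
        (\<forall>i<m. q i \<in> frontier (outside D)) \<and>
        (\<exists>(R::real) (\<theta> :: nat \<Rightarrow> real) (\<gamma> :: nat \<Rightarrow> real \<Rightarrow> complex).
           D \<subseteq> ball 0 R \<and>
           (\<forall>i<m. arc (\<gamma> i) \<and> pathstart (\<gamma> i) = q i \<and>
              pathfinish (\<gamma> i) = of_real R * cis (\<theta> i) \<and>
              path_image (\<gamma> i) - {pathstart (\<gamma> i), pathfinish (\<gamma> i)} \<subseteq> outside D \<inter> ball 0 R) \<and>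
           (\<forall>i<m. \<forall>j<m. i \<noteq> j \<longrightarrow> path_image (\<gamma> i) \<inter> path_image (\<gamma> j) = {}) \<and>
           (\<forall>i j. i < j \<and> j < m \<longrightarrow> \<theta> i < \<theta> j \<and> \<theta> j < \<theta> i + 2 * pi)))"

definition generator_matchgate :: "nat \<Rightarrow> 'v gate \<Rightarrow> bool" where
  "generator_matchgate m H \<longleftrightarrow> wf_gate H \<and> length (outputs H) = m \<and>
     (\<exists>p c. plane_drawing H p c \<and> outputs_ccw_on_outer_face H p c)"

definition delete_nodes :: "'v gate \<Rightarrow> 'v set \<Rightarrow> 'v gate" where
  "delete_nodes H Z = H\<lparr>nodes := nodes H - Z, edges := {e \<in> edges H. e \<inter> Z = {}}\<rparr>"

definition perfect_matchings :: "'v gate \<Rightarrow> 'v set set set" where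
  "perfect_matchings H = {N. N \<subseteq> edges H \<and> (\<forall>v\<in>nodes H. \<exists>!e. e \<in> N \<and> v \<in> e)}"

definition perf_match :: "'v gate \<Rightarrow> complex" where
  "perf_match H = (\<Sum>N\<in>perfect_matchings H. \<Prod>e\<in>N. weight H e)"

definition standard_signature :: "'v gate \<Rightarrow> complex Matrix.vec" where
  "standard_signature H = (let m = length (outputs H) in
     Matrix.vec (2 ^ m) (\<lambda>x.
       perf_match (delete_nodes H {outputs H ! s | s. s < m \<and> index_word 2 m x ! s = 1})))"

end

theory Submission
  imports Defs
begin

text \<open>
  View the signature as a function \<open>w\<close> on sets of outputs.  It satisfies the matchgate identities:
  in the union of two matchings, the vertices of odd degree are paired up by the components, the
  pairs do not cross because the gate is drawn in a disc, and exchanging the matchings on one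
  component is a sign-reversing involution.

  Let \<open>S\<close> be the outputs of block \<open>t\<close>.  If \<open>w Z * w (Z + aa'bb') = w (Z + aa') * w (Z + bb')\<close> for
  all \<open>a, a'\<close> in \<open>S\<close> and \<open>b, b'\<close> outside \<open>S\<close> (with \<open>+\<close> the symmetric difference), then the
  identities show by induction that each of the two parity blocks of the flattening has rank at
  most 1, so the flattening has rank at most 2.  That is impossible: as \<open>M\<close> is injective, a vector
  that annihilates two suitable columns of the tensor contracted with \<open>M\<close> on the other arguments
  would annihilate \<open>G(t)\<close>, whose rank is \<open>k \<ge> 3\<close>.  So one of these minors does not vanish.  By the
  four-term matchgate identity the minor on the rows \<open>Z + a, Z + a'\<close> and columns \<open>Z + b, Z + b'\<close>
  does not vanish either, and since the two lie in different parity blocks they form a nonsingular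
  \<open>4 \<times> 4\<close> submatrix.
\<close>

section \<open>Algebra of the matchgate identities\<close>

text \<open>Solving an expansion for the value at a large set means cancelling \<open>w {}\<close>,
  which may be 0. This obstacle shapes the algebra. Outputs are encoded as sets and bit flips as
  symmetric differences because the identities and the vanishing of minors are then invariant under
  translation of all arguments by a fixed set, so that any nonzero value can be moved to
  \<open>{}\<close>. The signs of the identities count positions, so what planarity has to supply is
  a parity: the two odd ends of a component have positions of opposite parity. A gate may be
  disconnected and the boundary of its outer face need not be a simple closed curve, so this is not
  read off a boundary cycle. The arcs that define the counterclockwise order are used instead: they
  prolong connections inside the drawing to paths ending on a circle, where a meeting theorem for
  two paths applies.\<close>

definition rank_in :: "nat set \<Rightarrow> nat \<Rightarrow> nat" where
  "rank_in D i = card {j \<in> D. j < i}"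

text \<open>Quadratic relations of Grassmann-Pluecker type: two patterns are flipped together at one
  position where they differ, with alternating signs along these positions in increasing
  order.\<close>

definition matchgate_identities :: "nat set \<Rightarrow> (nat set \<Rightarrow> complex) \<Rightarrow> bool" where
  "matchgate_identities U w \<longleftrightarrow> (\<forall>X Y. X \<subseteq> U \<longrightarrow> Y \<subseteq> U \<longrightarrow>
     (\<Sum>i\<in>sym_diff X Y. (-1) ^ rank_in (sym_diff X Y) i * (w (sym_diff X {i}) * w (sym_diff Y {i}))) = 0)"

lemma sym_diff_cancel: "sym_diff (sym_diff X Z) (sym_diff Y Z) = sym_diff X Y"
  by blast

lemma sym_diff_swap: "sym_diff (sym_diff X Y) Z = sym_diff (sym_diff X Z) Y"
  by blast

lemma sym_diff_subset: "X \<subseteq> U \<Longrightarrow> Y \<subseteq> U \<Longrightarrow> sym_diff X Y \<subseteq> U"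
  by blast

text \<open>The summation set and the signs depend on \<open>X\<close> and \<open>Y\<close> only
  through their symmetric difference, which does not change when both are translated by
  \<open>B\<close>.\<close>

lemma matchgate_identities_shift:
  assumes "matchgate_identities U w" "B \<subseteq> U"
  shows "matchgate_identities U (\<lambda>Z. w (sym_diff Z B))"
  unfolding matchgate_identities_def
proof (intro allI impI)
  fix X Y assume XY: "X \<subseteq> U" "Y \<subseteq> U"
  have "sym_diff X B \<subseteq> U" "sym_diff Y B \<subseteq> U"
    using XY assms(2) by blast+
  with assms(1) have "(\<Sum>i\<in>sym_diff (sym_diff X B) (sym_diff Y B).
      (-1) ^ rank_in (sym_diff (sym_diff X B) (sym_diff Y B)) i *
      (w (sym_diff (sym_diff X B) {i}) * w (sym_diff (sym_diff Y B) {i}))) = 0"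
    unfolding matchgate_identities_def by blast
  then show "(\<Sum>i\<in>sym_diff X Y. (-1) ^ rank_in (sym_diff X Y) i *
      (w (sym_diff (sym_diff X {i}) B) * w (sym_diff (sym_diff Y {i}) B))) = 0"
    unfolding sym_diff_cancel sym_diff_swap[of _ B] .
qed

text \<open>An interval of consecutive labels, encoded by comparisons because that is the form in
  which the counts of \<open>rank_in\<close> need it.\<close>

definition order_block :: "nat set \<Rightarrow> nat set \<Rightarrow> bool" where
  "order_block U S \<longleftrightarrow> S \<subseteq> U \<and> (\<forall>b\<in>U - S. \<forall>i\<in>S. \<forall>j\<in>S. b < i \<longleftrightarrow> b < j)"

text \<open>The four sets are the entries in the row \<open>Z \<inter> S\<close> and its translate
  by \<open>A\<close>, and in the column \<open>Z - S\<close> and its translate by \<open>B\<close>,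
  so the equation is a vanishing 2 by 2 minor. Flipping two elements keeps rows and columns in their
  parity class.\<close>

definition small_minors_vanish :: "nat set \<Rightarrow> nat set \<Rightarrow> (nat set \<Rightarrow> complex) \<Rightarrow> bool" where
  "small_minors_vanish U S w \<longleftrightarrow> (\<forall>Z A B. Z \<subseteq> U \<longrightarrow> A \<subseteq> S \<longrightarrow> B \<subseteq> U - S \<longrightarrow> card A = 2 \<longrightarrow> card B = 2 \<longrightarrow>
     w Z * w (sym_diff Z (A \<union> B)) = w (sym_diff Z A) * w (sym_diff Z B))"

lemma small_minors_vanish_shift:
  assumes "small_minors_vanish U S w" "C \<subseteq> U"
  shows "small_minors_vanish U S (\<lambda>Z. w (sym_diff Z C))"
  unfolding small_minors_vanish_def
proof (intro allI impI)
  fix Z A B assume *: "Z \<subseteq> U" "A \<subseteq> S" "B \<subseteq> U - S" "card A = 2" "card B = 2"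
  then have "sym_diff Z C \<subseteq> U" using assms(2) by blast
  with assms(1) * show "w (sym_diff Z C) * w (sym_diff (sym_diff Z (A \<union> B)) C) =
      w (sym_diff (sym_diff Z A) C) * w (sym_diff (sym_diff Z B) C)"
    unfolding small_minors_vanish_def sym_diff_swap[of _ _ C] by blast
qed

lemma rank_in_split:
  assumes "finite \<beta>" "finite \<alpha>" "\<alpha> \<inter> \<beta> = {}"
  shows "rank_in (\<alpha> \<union> \<beta>) i = rank_in \<alpha> i + rank_in \<beta> i"
proof -
  have "{j \<in> \<alpha> \<union> \<beta>. j < i} = {j \<in> \<alpha>. j < i} \<union> {j \<in> \<beta>. j < i}" by auto
  then show ?thesis unfolding rank_in_def using assms by (subst card_Un_disjoint[symmetric]) auto
qed

lemma rank_in_block_const: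
  assumes "order_block U S" "\<beta> \<subseteq> U - S" "i \<in> S" "j \<in> S"
  shows "rank_in \<beta> i = rank_in \<beta> j"
proof -
  have "{x \<in> \<beta>. x < i} = {x \<in> \<beta>. x < j}" using assms unfolding order_block_def by blast
  then show ?thesis by (simp add: rank_in_def)
qed

text \<open>The block lies on one side of \<open>b\<close>, so the count is either
  \<open>card \<alpha>\<close> or 0.\<close>

lemma rank_in_block_even:
  assumes "order_block U S" "\<alpha> \<subseteq> S" "b \<in> U - S" "even (card \<alpha>)"
  shows "even (rank_in \<alpha> b)"
proof (cases "\<exists>i\<in>\<alpha>. i < b")
  case True
  then obtain i where i: "i \<in> \<alpha>" "i < b" by blast
  have "j < b" if "j \<in> \<alpha>" for j
  proof -
    have "j \<in> S" "i \<in> S" using that i assms(2) by auto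
    then have "b < j \<longleftrightarrow> b < i" using assms(1,3) unfolding order_block_def by blast
    moreover have "j \<noteq> b" using assms(3) \<open>j \<in> S\<close> by auto
    ultimately show ?thesis using i by linarith
  qed
  then have "{j \<in> \<alpha>. j < b} = \<alpha>" by blast
  then show ?thesis using assms(4) by (simp add: rank_in_def)
next
  case False
  then have "{j \<in> \<alpha>. j < b} = {}" by blast
  then show ?thesis unfolding rank_in_def by (metis card.empty even_zero)
qed

text \<open>The bound restricts the flips \<open>A\<close> and \<open>B\<close> and leaves the base
  point \<open>Z\<close> free, since the induction keeps changing the base point.\<close>

definition even_minors_vanish :: "nat set \<Rightarrow> nat set \<Rightarrow> (nat set \<Rightarrow> complex) \<Rightarrow> nat \<Rightarrow> bool" where
  "even_minors_vanish U S w N \<longleftrightarrow> (\<forall>Z A B. Z \<subseteq> U \<longrightarrow> A \<subseteq> S \<longrightarrow> B \<subseteq> U - S \<longrightarrow> even (card A) \<longrightarrow> even (card B) \<longrightarrow>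
     card A + card B < N \<longrightarrow> w Z * w (sym_diff Z (A \<union> B)) = w (sym_diff Z A) * w (sym_diff Z B))"

lemma even_minors_vanishD:
  assumes "even_minors_vanish U S w N" "Z \<subseteq> U" "A \<subseteq> S" "B \<subseteq> U - S" "even (card A)" "even (card B)"
    "card A + card B < N"
  shows "w Z * w (sym_diff Z (A \<union> B)) = w (sym_diff Z A) * w (sym_diff Z B)"
  using assms unfolding even_minors_vanish_def by blast

text \<open>
  The part, crossing between \<open>\<alpha>\<close> and \<open>\<beta>\<close>, of the expansion of \<open>w (\<alpha> \<union> \<beta>)\<close> along \<open>a\<close>.  Unless some
  \<open>a\<close> makes all its terms zero, the smaller minors turn it into a multiple of the expansion of
  \<open>{c} \<union> \<beta>\<close> along \<open>c\<close>, which is a matchgate identity.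
\<close>

lemma cross_sum_vanishes:
  assumes fin: "finite U" and blk: "order_block U S" and mi: "matchgate_identities U w"
    and small: "small_minors_vanish U S w"
    and IH: "even_minors_vanish U S w (card \<alpha> + card \<beta>)"
    and ab: "\<alpha> \<subseteq> S" "\<beta> \<subseteq> U - S" "even (card \<alpha>)" "even (card \<beta>)" "\<alpha> \<noteq> {}" "\<beta> \<noteq> {}"
  shows "\<exists>a\<in>\<alpha>. (\<Sum>i\<in>\<beta>. (-1) ^ rank_in \<beta> i * (w ((\<alpha> - {a}) \<union> (\<beta> - {i})) * w {a, i})) = 0"
proof (cases "\<exists>a\<in>\<alpha>. \<forall>i\<in>\<beta>. w {a, i} = 0")
  case True
  then obtain a where "a \<in> \<alpha>" "\<And>i. i \<in> \<beta> \<Longrightarrow> w {a, i} = 0" by blast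
  then show ?thesis by (intro bexI[of _ a] sum.neutral) auto
next
  case False
  have SU: "S \<subseteq> U" using blk by (simp add: order_block_def)
  have fab: "finite \<alpha>" "finite \<beta>" using fin SU ab(1,2) by (meson Diff_subset finite_subset subset_trans)+
  have "card \<alpha> \<noteq> 0" "card \<beta> \<noteq> 0" using fab ab by auto
  with ab have c2: "card \<alpha> \<ge> 2" "card \<beta> \<ge> 2" by presburger+
  obtain a where a: "a \<in> \<alpha>" using ab by blast
  have "\<alpha> \<noteq> {a}" using c2 by auto
  then obtain c where c: "c \<in> \<alpha>" "c \<noteq> a" using a by blast
  \<comment> \<open>\<open>w {c, j}\<close> is the pivot: the sum is multiplied by its square and
    divided by it at the end.\<close>
  obtain j where j: "j \<in> \<beta>" "w {c, j} \<noteq> 0" using False c by blast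
  let ?e = "\<lambda>i. (-1) ^ rank_in \<beta> i :: complex"
  have mic: "(\<Sum>i\<in>\<beta>. ?e i * (w {c, i} * w (insert c (\<beta> - {i})))) = 0"
  proof -
    have s: "sym_diff {c} (insert c \<beta>) = \<beta>" using c ab by blast
    have "{c} \<subseteq> U" "insert c \<beta> \<subseteq> U" using c ab SU by blast+
    with mi have "(\<Sum>i\<in>sym_diff {c} (insert c \<beta>). (-1) ^ rank_in (sym_diff {c} (insert c \<beta>)) i *
        (w (sym_diff {c} {i}) * w (sym_diff (insert c \<beta>) {i}))) = 0"
      unfolding matchgate_identities_def by blast
    then have "(\<Sum>i\<in>\<beta>. ?e i * (w (sym_diff {c} {i}) * w (sym_diff (insert c \<beta>) {i}))) = 0"
      unfolding s .
    moreover have "sym_diff {c} {i} = {c, i}" "sym_diff (insert c \<beta>) {i} = insert c (\<beta> - {i})"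
      if "i \<in> \<beta>" for i using that c ab by blast+
    ultimately show ?thesis by simp
  qed
  \<comment> \<open>The flips \<open>\<alpha> - {a} - {c}\<close> and \<open>\<beta>\<close> have
    two elements fewer in total than \<open>\<alpha>\<close> and \<open>\<beta>\<close>.\<close>
  have F1: "w ((\<alpha> - {a}) \<union> (\<beta> - {i})) * w {c, i} = w (insert i (\<alpha> - {a})) * w (insert c (\<beta> - {i}))"
    if i: "i \<in> \<beta>" for i
  proof -
    let ?Z = "insert i (\<alpha> - {a})"
    have "card (\<alpha> - {a} - {c}) = card \<alpha> - 2" using fab a c by simp
    then have "w ?Z * w (sym_diff ?Z ((\<alpha> - {a} - {c}) \<union> \<beta>)) =
        w (sym_diff ?Z (\<alpha> - {a} - {c})) * w (sym_diff ?Z \<beta>)"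
      using i c2 ab SU by (intro even_minors_vanishD[OF IH]) auto
    moreover have "sym_diff ?Z ((\<alpha> - {a} - {c}) \<union> \<beta>) = insert c (\<beta> - {i})"
      "sym_diff ?Z (\<alpha> - {a} - {c}) = {c, i}" "sym_diff ?Z \<beta> = (\<alpha> - {a}) \<union> (\<beta> - {i})"
      using i a c ab by blast+
    ultimately show ?thesis by (simp add: mult.commute)
  qed
  \<comment> \<open>The flips \<open>{a, c}\<close> and \<open>{i, j}\<close> are too large for
    \<open>IH\<close> when \<open>\<alpha>\<close> and \<open>\<beta>\<close> have two elements
    each; this is where the small minors start the induction.\<close>
  have F2: "w {a, i} * w {c, j} = w {a, j} * w {c, i}" if i: "i \<in> \<beta>" for i
  proof (cases "i = j")
    case False
    have "{a, i} \<subseteq> U" "{a, c} \<subseteq> S" "{i, j} \<subseteq> U - S" using i j a c ab SU by blast+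
    moreover have "card {a, c} = 2" "card {i, j} = 2" using c False by simp_all
    ultimately have "w {a, i} * w (sym_diff {a, i} ({a, c} \<union> {i, j})) = w (sym_diff {a, i} {a, c}) * w (sym_diff {a, i} {i, j})"
      using small unfolding small_minors_vanish_def by blast
    moreover have "sym_diff {a, i} ({a, c} \<union> {i, j}) = {c, j}" "sym_diff {a, i} {a, c} = {c, i}"
      "sym_diff {a, i} {i, j} = {a, j}"
      using i j a c ab False by blast+
    ultimately show ?thesis by (simp add: mult.commute)
  qed simp
  \<comment> \<open>The flips \<open>\<alpha> - {a} - {c}\<close> and \<open>{i, j}\<close> have
    total size \<open>card \<alpha>\<close>, below the bound because \<open>\<beta>\<close> is
    nonempty.\<close>
  have F3: "w (insert i (\<alpha> - {a})) * w {c, j} = w (insert j (\<alpha> - {a})) * w {c, i}" if i: "i \<in> \<beta>" for i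
  proof (cases "i = j")
    case False
    let ?Z = "insert i (\<alpha> - {a})"
    have "card (\<alpha> - {a} - {c}) = card \<alpha> - 2" "card {i, j} = 2" using fab a c False by simp_all
    then have "w ?Z * w (sym_diff ?Z ((\<alpha> - {a} - {c}) \<union> {i, j})) =
        w (sym_diff ?Z (\<alpha> - {a} - {c})) * w (sym_diff ?Z {i, j})"
      using i j c2 ab SU by (intro even_minors_vanishD[OF IH]) auto
    moreover have "sym_diff ?Z ((\<alpha> - {a} - {c}) \<union> {i, j}) = {c, j}"
      "sym_diff ?Z (\<alpha> - {a} - {c}) = {c, i}" "sym_diff ?Z {i, j} = insert j (\<alpha> - {a})"
      using i j a c ab False by blast+
    ultimately show ?thesis by (simp add: mult.commute)
  qed simp
  \<comment> \<open>One factor \<open>w {c, j}\<close> is used up by \<open>F2\<close>, the other by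
    \<open>F3\<close>. The coefficient that remains on the right does not depend on
    \<open>i\<close>, so summation yields a multiple of \<open>mic\<close>.\<close>
  have key: "w ((\<alpha> - {a}) \<union> (\<beta> - {i})) * w {a, i} * (w {c, j} * w {c, j}) =
      w {a, j} * w (insert j (\<alpha> - {a})) * (w {c, i} * w (insert c (\<beta> - {i})))" if i: "i \<in> \<beta>" for i
  proof -
    have "w ((\<alpha> - {a}) \<union> (\<beta> - {i})) * w {a, i} * (w {c, j} * w {c, j}) =
        w ((\<alpha> - {a}) \<union> (\<beta> - {i})) * (w {a, i} * w {c, j}) * w {c, j}" by simp
    also have "\<dots> = (w ((\<alpha> - {a}) \<union> (\<beta> - {i})) * w {c, i}) * w {a, j} * w {c, j}"
      unfolding F2[OF i] by simp
    also have "\<dots> = (w (insert i (\<alpha> - {a})) * w {c, j}) * w (insert c (\<beta> - {i})) * w {a, j}"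
      unfolding F1[OF i] by simp
    finally show ?thesis unfolding F3[OF i] by simp
  qed
  have "(\<Sum>i\<in>\<beta>. ?e i * (w ((\<alpha> - {a}) \<union> (\<beta> - {i})) * w {a, i})) * (w {c, j} * w {c, j}) =
      (\<Sum>i\<in>\<beta>. ?e i * (w ((\<alpha> - {a}) \<union> (\<beta> - {i})) * w {a, i} * (w {c, j} * w {c, j})))"
    by (simp add: sum_distrib_right mult.assoc)
  also have "\<dots> = (\<Sum>i\<in>\<beta>. ?e i * (w {a, j} * w (insert j (\<alpha> - {a})) * (w {c, i} * w (insert c (\<beta> - {i})))))"
    by (intro sum.cong refl) (simp only: key)
  also have "\<dots> = w {a, j} * w (insert j (\<alpha> - {a})) * (\<Sum>i\<in>\<beta>. ?e i * (w {c, i} * w (insert c (\<beta> - {i}))))"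
    unfolding sum_distrib_left by (intro sum.cong refl) simp
  finally show ?thesis unfolding mic using j a by auto
qed

text \<open>Expand the union along the element \<open>a\<close> that
  \<open>cross_sum_vanishes\<close> provides. The terms from \<open>\<beta>\<close> add up to zero.
  After multiplication by \<open>w {}\<close>, the hypothesis \<open>IH\<close> splits
  \<open>w \<beta>\<close> off the terms from \<open>\<alpha> - {a}\<close>, which leaves the
  expansion of \<open>\<alpha>\<close> alone; comparing the two expansions and cancelling
  \<open>w {}\<close> gives the claim.\<close>

lemma even_minor_at_empty:
  assumes fin: "finite U" and blk: "order_block U S" and mi: "matchgate_identities U w"
    and small: "small_minors_vanish U S w" and w0: "w {} \<noteq> 0"
    and IH: "even_minors_vanish U S w (card \<alpha> + card \<beta>)"
    and ab: "\<alpha> \<subseteq> S" "\<beta> \<subseteq> U - S" "even (card \<alpha>)" "even (card \<beta>)"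
  shows "w {} * w (\<alpha> \<union> \<beta>) = w \<alpha> * w \<beta>"
proof (cases "\<alpha> = {} \<or> \<beta> = {}")
  case False
  have SU: "S \<subseteq> U" using blk by (simp add: order_block_def)
  have fab: "finite \<alpha>" "finite \<beta>" using fin SU ab(1,2) by (meson Diff_subset finite_subset subset_trans)+
  have disj: "\<alpha> \<inter> \<beta> = {}" using ab by blast
  obtain a where a: "a \<in> \<alpha>"
    and T: "(\<Sum>i\<in>\<beta>. (-1) ^ rank_in \<beta> i * (w ((\<alpha> - {a}) \<union> (\<beta> - {i})) * w {a, i})) = 0"
    using cross_sum_vanishes[OF fin blk mi small IH ab] False by blast
  let ?Z = "\<alpha> \<union> \<beta>"
  let ?s = "\<lambda>i. (-1) ^ rank_in \<alpha> i :: complex"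
  \<comment> \<open>The common sign contributed by \<open>\<beta>\<close> to all terms from
    \<open>\<alpha>\<close>: no element of \<open>\<beta>\<close> lies between two elements of the
    block.\<close>
  let ?K = "(-1) ^ rank_in \<beta> a :: complex"
  have expand: "(\<Sum>i\<in>Y. (-1) ^ rank_in Y i * (w (sym_diff {a} {i}) * w (sym_diff (Y - {a}) {i}))) = 0"
    if "a \<in> Y" "Y \<subseteq> U" for Y
  proof -
    have s: "sym_diff {a} (Y - {a}) = Y" using that by blast
    have "{a} \<subseteq> U" "Y - {a} \<subseteq> U" using that by blast+
    with mi have "(\<Sum>i\<in>sym_diff {a} (Y - {a}). (-1) ^ rank_in (sym_diff {a} (Y - {a})) i *
        (w (sym_diff {a} {i}) * w (sym_diff (Y - {a}) {i}))) = 0"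
      unfolding matchgate_identities_def by blast
    then show ?thesis unfolding s .
  qed
  \<comment> \<open>The expansion of \<open>\<alpha>\<close> along \<open>a\<close> without the term
    that contains \<open>w \<alpha>\<close>; the identity for \<open>\<alpha>\<close> evaluates
    it.\<close>
  define P where "P = (\<Sum>i\<in>\<alpha> - {a}. ?s i * (w {a, i} * w (\<alpha> - {a} - {i})))"
  have split_sum: "(\<Sum>i\<in>\<alpha>. f i) = f a + (\<Sum>i\<in>\<alpha> - {a}. f i)" for f :: "nat \<Rightarrow> complex"
    using fab a by (simp add: sum.remove)
  have "(\<Sum>i\<in>\<alpha>. ?s i * (w (sym_diff {a} {i}) * w (sym_diff (\<alpha> - {a}) {i}))) = 0"
    using expand[of \<alpha>] a ab SU by blast
  moreover have "(\<Sum>i\<in>\<alpha>. ?s i * (w (sym_diff {a} {i}) * w (sym_diff (\<alpha> - {a}) {i}))) = ?s a * (w {} * w \<alpha>) + P"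
  proof -
    have "sym_diff {a} {i} = {a, i}" "sym_diff (\<alpha> - {a}) {i} = \<alpha> - {a} - {i}" if "i \<in> \<alpha> - {a}" for i
      using that by blast+
    then have "(\<Sum>i\<in>\<alpha> - {a}. ?s i * (w (sym_diff {a} {i}) * w (sym_diff (\<alpha> - {a}) {i}))) = P"
      unfolding P_def by (intro sum.cong refl) simp
    moreover have "sym_diff {a} {a} = {}" "sym_diff (\<alpha> - {a}) {a} = \<alpha>" using a by blast+
    ultimately show ?thesis unfolding split_sum by simp
  qed
  ultimately have P: "P = - ?s a * (w {} * w \<alpha>)" by (simp add: eq_neg_iff_add_eq_0 add.commute)
  have "0 = w {} * (\<Sum>i\<in>?Z. (-1) ^ rank_in ?Z i * (w (sym_diff {a} {i}) * w (sym_diff (?Z - {a}) {i})))"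
    using expand[of ?Z] a ab SU by auto
  also have "(\<Sum>i\<in>?Z. (-1) ^ rank_in ?Z i * (w (sym_diff {a} {i}) * w (sym_diff (?Z - {a}) {i}))) =
      (\<Sum>i\<in>\<alpha>. (-1) ^ rank_in ?Z i * (w (sym_diff {a} {i}) * w (sym_diff (?Z - {a}) {i}))) +
      (\<Sum>i\<in>\<beta>. (-1) ^ rank_in ?Z i * (w (sym_diff {a} {i}) * w (sym_diff (?Z - {a}) {i})))"
    using fab disj by (intro sum.union_disjoint) auto
  also have "(\<Sum>i\<in>\<beta>. (-1) ^ rank_in ?Z i * (w (sym_diff {a} {i}) * w (sym_diff (?Z - {a}) {i}))) =
      (\<Sum>i\<in>\<beta>. (-1) ^ rank_in \<beta> i * (w ((\<alpha> - {a}) \<union> (\<beta> - {i})) * w {a, i}))"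
  proof (rule sum.cong[OF refl])
    fix i assume i: "i \<in> \<beta>"
    have "even (rank_in \<alpha> i)" using rank_in_block_even[OF blk ab(1) _ ab(3)] i ab by blast
    then have "(-1) ^ rank_in ?Z i = ((-1) ^ rank_in \<beta> i :: complex)"
      unfolding rank_in_split[OF fab(2,1) disj] by (simp add: power_add)
    moreover have "sym_diff {a} {i} = {a, i}" "sym_diff (?Z - {a}) {i} = (\<alpha> - {a}) \<union> (\<beta> - {i})"
      using i a disj by blast+
    ultimately show "(-1) ^ rank_in ?Z i * (w (sym_diff {a} {i}) * w (sym_diff (?Z - {a}) {i})) =
        (-1) ^ rank_in \<beta> i * (w ((\<alpha> - {a}) \<union> (\<beta> - {i})) * w {a, i})" by simp
  qed
  also have "\<dots> = 0" by (fact T)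
  also have "(\<Sum>i\<in>\<alpha>. (-1) ^ rank_in ?Z i * (w (sym_diff {a} {i}) * w (sym_diff (?Z - {a}) {i}))) =
      (\<Sum>i\<in>\<alpha>. ?K * (?s i * (w (sym_diff {a} {i}) * w (sym_diff (?Z - {a}) {i}))))"
  proof (rule sum.cong[OF refl])
    fix i assume "i \<in> \<alpha>"
    then have "rank_in \<beta> i = rank_in \<beta> a" using rank_in_block_const[OF blk ab(2)] a ab by blast
    then show "(-1) ^ rank_in ?Z i * (w (sym_diff {a} {i}) * w (sym_diff (?Z - {a}) {i})) =
       ?K * (?s i * (w (sym_diff {a} {i}) * w (sym_diff (?Z - {a}) {i})))"
      unfolding rank_in_split[OF fab(2,1) disj] by (simp add: power_add)
  qed
  finally have "0 = ?K * (w {} * (\<Sum>i\<in>\<alpha>. ?s i * (w (sym_diff {a} {i}) * w (sym_diff (?Z - {a}) {i}))))"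
    by (simp add: sum_distrib_left mult.assoc mult.left_commute)
  then have "w {} * (\<Sum>i\<in>\<alpha>. ?s i * (w (sym_diff {a} {i}) * w (sym_diff (?Z - {a}) {i}))) = 0" by simp
  moreover have "w {} * (\<Sum>i\<in>\<alpha>. ?s i * (w (sym_diff {a} {i}) * w (sym_diff (?Z - {a}) {i}))) =
      ?s a * (w {} * (w {} * w ?Z)) + P * w \<beta>"
  proof -
    have "(\<Sum>i\<in>\<alpha> - {a}. w {} * (?s i * (w (sym_diff {a} {i}) * w (sym_diff (?Z - {a}) {i})))) =
        (\<Sum>i\<in>\<alpha> - {a}. ?s i * (w {a, i} * w (\<alpha> - {a} - {i})) * w \<beta>)"
    proof (rule sum.cong[OF refl])
      fix i assume i: "i \<in> \<alpha> - {a}"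
      have "{a, i} \<subseteq> \<alpha>" "card {a, i} = 2" using i a by auto
      then have "card \<alpha> \<ge> 2" using fab card_mono by metis
      moreover have "card (\<alpha> - {a} - {i}) = card \<alpha> - 2" using i a fab by simp
      ultimately have "w {} * w (sym_diff {} ((\<alpha> - {a} - {i}) \<union> \<beta>)) = w (sym_diff {} (\<alpha> - {a} - {i})) * w (sym_diff {} \<beta>)"
        using ab by (intro even_minors_vanishD[OF IH]) auto
      then have "w {} * w ((\<alpha> - {a} - {i}) \<union> \<beta>) = w (\<alpha> - {a} - {i}) * w \<beta>" by simp
      moreover have "sym_diff {a} {i} = {a, i}" "sym_diff (?Z - {a}) {i} = (\<alpha> - {a} - {i}) \<union> \<beta>"
        using i a disj by blast+
      ultimately show "w {} * (?s i * (w (sym_diff {a} {i}) * w (sym_diff (?Z - {a}) {i}))) =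
          ?s i * (w {a, i} * w (\<alpha> - {a} - {i})) * w \<beta>"
        by (simp add: mult.left_commute mult.assoc)
    qed
    moreover have "sym_diff {a} {a} = {}" "sym_diff (?Z - {a}) {a} = ?Z" using a by blast+
    ultimately show ?thesis
      unfolding split_sum distrib_left sum_distrib_left P_def sum_distrib_right by (simp add: mult.left_commute)
  qed
  ultimately have "?s a * (w {} * (w {} * w ?Z - w \<alpha> * w \<beta>)) = 0"
    unfolding P by (simp add: algebra_simps)
  then show ?thesis using w0 by simp
qed auto

text \<open>The equation has the same shape seen from \<open>Z\<close> and from
  \<open>sym_diff Z A\<close>. If one of the two values is nonzero, it is translated to
  \<open>{}\<close>; if both are zero, each side contains a zero factor. Translation replaces
  \<open>w\<close>, so the induction has to let \<open>w\<close> vary.\<close>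

lemma even_minors_vanish:
  assumes fin: "finite U" and blk: "order_block U S" 
  shows "matchgate_identities U w \<Longrightarrow> small_minors_vanish U S w \<Longrightarrow> even_minors_vanish U S w N"
proof (induction N arbitrary: w)
  case 0
  then show ?case by (simp add: even_minors_vanish_def)
next
  case (Suc N)
  have SU: "S \<subseteq> U" using blk by (simp add: order_block_def)
  have main: "v {} * v (A \<union> B) = v A * v B"
    if v: "matchgate_identities U v" "small_minors_vanish U S v" "v {} \<noteq> 0"
      and AB: "A \<subseteq> S" "B \<subseteq> U - S" "even (card A)" "even (card B)" "card A + card B = N" for v A B
    using even_minor_at_empty[OF fin blk v(1,2,3) _ AB(1-4)] Suc.IH[OF v(1,2)] AB(5) by simp
  have "w Z * w (sym_diff Z (A \<union> B)) = w (sym_diff Z A) * w (sym_diff Z B)"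
    if Z: "Z \<subseteq> U" and AB: "A \<subseteq> S" "B \<subseteq> U - S" "even (card A)" "even (card B)" "card A + card B = N" for Z A B
  proof -
    have at: "w Y * w (sym_diff (A \<union> B) Y) = w (sym_diff A Y) * w (sym_diff B Y)" if "Y \<subseteq> U" "w Y \<noteq> 0" for Y
      using main[OF matchgate_identities_shift[OF Suc.prems(1) that(1)] small_minors_vanish_shift[OF Suc.prems(2) that(1)] _ AB]
        that(2) by simp
    consider "w Z \<noteq> 0" | "w (sym_diff Z A) \<noteq> 0" | "w Z = 0" "w (sym_diff Z A) = 0" by blast
    then show ?thesis
    proof cases
      case 1
      then show ?thesis using at[OF Z] by (simp add: Un_commute)
    next
      case 2
      have "sym_diff Z A \<subseteq> U" using Z AB SU by blast
      moreover have "sym_diff (A \<union> B) (sym_diff Z A) = sym_diff Z B" "sym_diff A (sym_diff Z A) = Z"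
        "sym_diff B (sym_diff Z A) = sym_diff Z (A \<union> B)"
        using AB by blast+
      ultimately show ?thesis using at[of "sym_diff Z A"] 2 by simp
    qed simp
  qed
  then show ?case using Suc.IH[OF Suc.prems] unfolding even_minors_vanish_def less_Suc_eq by blast
qed

section \<open>Parity classes and 2 by 2 minors\<close>

definition parity_supported :: "nat set \<Rightarrow> (nat set \<Rightarrow> complex) \<Rightarrow> bool" where
  "parity_supported U w \<longleftrightarrow> (\<forall>X Y. X \<subseteq> U \<longrightarrow> Y \<subseteq> U \<longrightarrow> w X \<noteq> 0 \<longrightarrow> w Y \<noteq> 0 \<longrightarrow> (even (card X) \<longleftrightarrow> even (card Y)))"

lemma even_card_sym_diff:
  assumes "finite X" "finite Y"
  shows "even (card (sym_diff X Y)) \<longleftrightarrow> (even (card X) \<longleftrightarrow> even (card Y))"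
proof -
  have "card (sym_diff X Y) = card (X - Y) + card (Y - X)"
    using assms by (intro card_Un_disjoint) auto
  moreover have "card X = card (X - Y) + card (X \<inter> Y)"
    using assms by (metis Un_Diff_Int card_Un_disjoint finite_Diff finite_Int Diff_Diff_Int Diff_disjoint Int_commute)
  moreover have "card Y = card (Y - X) + card (X \<inter> Y)"
    using assms by (metis Un_Diff_Int card_Un_disjoint finite_Diff finite_Int Diff_Diff_Int Diff_disjoint Int_commute)
  ultimately show ?thesis by presburger
qed

text \<open>The identity for \<open>sym_diff Z {a}\<close> and \<open>sym_diff Z {a', b, b'}\<close>
  consists of exactly these four products. Since \<open>S\<close> is consecutive, the signs group
  them into the two minors, which therefore agree up to sign.\<close>

lemma four_term_identity:
  assumes mi: "matchgate_identities U w" and blk: "order_block U S" and Z: "Z \<subseteq> U"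
    and a: "a \<in> S" "a' \<in> S" "a < a'" and b: "b \<in> U - S" "b' \<in> U - S" "b < b'"
  shows "w Z * w (sym_diff Z ({a, a'} \<union> {b, b'})) = w (sym_diff Z {a, a'}) * w (sym_diff Z {b, b'}) \<longleftrightarrow>
    w (sym_diff Z {a, b}) * w (sym_diff Z {a', b'}) = w (sym_diff Z {a, b'}) * w (sym_diff Z {a', b})"
proof -
  have SU: "S \<subseteq> U" using blk by (simp add: order_block_def)
  let ?X = "sym_diff Z {a}" and ?Y = "sym_diff Z {a', b, b'}" and ?D = "{a, a'} \<union> {b, b'}"
  have ne: "a \<noteq> a'" "b \<noteq> b'" "a \<noteq> b" "a \<noteq> b'" "a' \<noteq> b" "a' \<noteq> b'" using a b by auto
  have D: "sym_diff ?X ?Y = ?D" using ne by blast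
  have "?X \<subseteq> U" "?Y \<subseteq> U" using a b Z SU by blast+
  with mi have "(\<Sum>i\<in>sym_diff ?X ?Y. (-1) ^ rank_in (sym_diff ?X ?Y) i * (w (sym_diff ?X {i}) * w (sym_diff ?Y {i}))) = 0"
    unfolding matchgate_identities_def by blast
  then have "(\<Sum>i\<in>?D. (-1) ^ rank_in ?D i * (w (sym_diff ?X {i}) * w (sym_diff ?Y {i}))) = 0"
    unfolding D .
  moreover have rD: "rank_in ?D i = rank_in {a, a'} i + rank_in {b, b'} i" for i
    using ne by (intro rank_in_split) auto
  moreover have r: "rank_in {a, a'} a = 0" "rank_in {b, b'} b = 0" "rank_in {a, a'} a' = 1" "rank_in {b, b'} b' = 1"
  proof -
    have "{j. (j = a \<or> j = a') \<and> j < a} = {}" "{j. (j = a \<or> j = a') \<and> j < a'} = {a}"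
      "{j. (j = b \<or> j = b') \<and> j < b} = {}" "{j. (j = b \<or> j = b') \<and> j < b'} = {b}" using a b by auto
    then show "rank_in {a, a'} a = 0" "rank_in {b, b'} b = 0" "rank_in {a, a'} a' = 1" "rank_in {b, b'} b' = 1"
      by (simp_all add: rank_in_def)
  qed
  moreover have "rank_in {b, b'} a' = rank_in {b, b'} a"
    using rank_in_block_const[OF blk _ a(2,1)] b by simp
  moreover have "even (rank_in {a, a'} b)" "even (rank_in {a, a'} b')"
    using rank_in_block_even[OF blk] a b by auto
  moreover have "sym_diff ?X {a} = Z" "sym_diff ?Y {a} = sym_diff Z ?D"
    "sym_diff ?X {a'} = sym_diff Z {a, a'}" "sym_diff ?Y {a'} = sym_diff Z {b, b'}"
    "sym_diff ?X {b} = sym_diff Z {a, b}" "sym_diff ?Y {b} = sym_diff Z {a', b'}"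
    "sym_diff ?X {b'} = sym_diff Z {a, b'}" "sym_diff ?Y {b'} = sym_diff Z {a', b}"
    using ne by blast+
  moreover have "(\<Sum>i\<in>?D. f i) = f a + f a' + f b + f b'" for f :: "nat \<Rightarrow> complex"
    using ne by (simp add: add.assoc)
  ultimately have "(-1) ^ rank_in {b, b'} a * (w Z * w (sym_diff Z ?D) - w (sym_diff Z {a, a'}) * w (sym_diff Z {b, b'})) +
     (w (sym_diff Z {a, b}) * w (sym_diff Z {a', b'}) - w (sym_diff Z {a, b'}) * w (sym_diff Z {a', b})) = 0"
    by (simp add: power_add algebra_simps)
  then show ?thesis
    by (metis (no_types, lifting) add.right_neutral add_cancel_right_left eq_iff_diff_eq_0 mult_eq_0_iff mult_zero_right
        power_not_zero zero_neq_neg_one)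
qed

text \<open>The second pair of rows and columns arises from the first by single flips. An entry
  mixing the two pairs is thus an odd number of flips away from a nonzero entry of the first minor,
  and parity makes it zero.\<close>

lemma nonvanishing_minor_pair:
  fixes w :: "nat set \<Rightarrow> complex"
  assumes fin: "finite U" and mi: "matchgate_identities U w" and blk: "order_block U S"
    and par: "parity_supported U w" and ns: "\<not> small_minors_vanish U S w"
  defines "F \<equiv> \<lambda>\<alpha> \<beta>. w (\<alpha> \<union> \<beta>)"
  obtains r1 r2 r3 r4 c1 c2 c3 c4 where
    "r1 \<subseteq> S" "r2 \<subseteq> S" "r3 \<subseteq> S" "r4 \<subseteq> S"
    "c1 \<subseteq> U - S" "c2 \<subseteq> U - S" "c3 \<subseteq> U - S" "c4 \<subseteq> U - S"
    "F r1 c1 * F r2 c2 \<noteq> F r1 c2 * F r2 c1" "F r3 c3 * F r4 c4 \<noteq> F r3 c4 * F r4 c3"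
    "F r1 c3 = 0" "F r1 c4 = 0" "F r2 c3 = 0" "F r2 c4 = 0"
    "F r3 c1 = 0" "F r3 c2 = 0" "F r4 c1 = 0" "F r4 c2 = 0"
proof -
  have SU: "S \<subseteq> U" using blk by (simp add: order_block_def)
  obtain Z A B where Z: "Z \<subseteq> U" and A: "A \<subseteq> S" "card A = 2" and B: "B \<subseteq> U - S" "card B = 2"
    and m: "w Z * w (sym_diff Z (A \<union> B)) \<noteq> w (sym_diff Z A) * w (sym_diff Z B)"
    using ns unfolding small_minors_vanish_def by blast
  obtain a a' where a: "A = {a, a'}" "a < a'" using A(2) by (metis card_2_iff insert_commute linorder_neqE_nat)
  obtain b b' where b: "B = {b, b'}" "b < b'" using B(2) by (metis card_2_iff insert_commute linorder_neqE_nat)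
  have ab: "a \<in> S" "a' \<in> S" "b \<in> U - S" "b' \<in> U - S" using a b A B by auto
  have m': "w (sym_diff Z {a, b}) * w (sym_diff Z {a', b'}) \<noteq> w (sym_diff Z {a, b'}) * w (sym_diff Z {a', b})"
    using four_term_identity[OF mi blk Z ab(1,2) a(2) ab(3,4) b(2)] m a b by simp
  define \<alpha> \<beta> where "\<alpha> = Z \<inter> S" and "\<beta> = Z - S"
  have \<alpha>\<beta>: "\<alpha> \<subseteq> S" "\<beta> \<subseteq> U - S" using Z by (auto simp: \<alpha>_def \<beta>_def)
  have F: "F (sym_diff \<alpha> C) (sym_diff \<beta> D) = w (sym_diff Z (C \<union> D))" if "C \<subseteq> S" "D \<subseteq> U - S" for C D
  proof -
    have "sym_diff \<alpha> C \<union> sym_diff \<beta> D = sym_diff Z (C \<union> D)" using that Z by (auto simp: \<alpha>_def \<beta>_def)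
    then show ?thesis by (simp add: F_def)
  qed
  have finU: "finite X" if "X \<subseteq> U" for X using that fin finite_subset by blast
  have zero: "F (sym_diff \<alpha> C) (sym_diff \<beta> D) = 0" if CD: "C \<subseteq> S" "D \<subseteq> U - S" "odd (card (C \<union> D))" for C D
  proof (rule ccontr)
    assume "F (sym_diff \<alpha> C) (sym_diff \<beta> D) \<noteq> 0"
    then have nz: "w (sym_diff Z (C \<union> D)) \<noteq> 0" using F CD by simp
    have ev: "even (card X)" if "X \<subseteq> U" "w (sym_diff Z X) \<noteq> 0" "X = {} \<or> X = A \<union> B \<or> X = A \<or> X = B" for X
    proof -
      have "A \<inter> B = {}" using A B by blast
      then have "card (A \<union> B) = 4" using A B finU[of A] finU[of B] SU by (subst card_Un_disjoint) auto
      then show ?thesis using that A B by auto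
    qed
    \<comment> \<open>The reference for the parity: one product of the minor contains
      \<open>w Z\<close>, the other \<open>w (sym_diff Z A)\<close>, so these are not both
      zero.\<close>
    obtain X where X: "X \<subseteq> U" "w (sym_diff Z X) \<noteq> 0" "even (card X)"
    proof -
      have "w Z \<noteq> 0 \<or> w (sym_diff Z A) \<noteq> 0" using m by auto
      then show thesis
      proof
        assume "w Z \<noteq> 0" then show thesis using that[of "{}"] by simp
      next
        assume "w (sym_diff Z A) \<noteq> 0" then show thesis using that[of A] A SU by auto
      qed
    qed
    have "C \<union> D \<subseteq> U" using CD SU by blast
    have "even (card (sym_diff Z X)) \<longleftrightarrow> even (card (sym_diff Z (C \<union> D)))"
      using par X nz Z \<open>C \<union> D \<subseteq> U\<close> unfolding parity_supported_def by (metis sym_diff_subset)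
    then show False
      using X(3) CD(3) even_card_sym_diff[OF finU[OF Z] finU[OF X(1)]]
        even_card_sym_diff[OF finU[OF Z] finU[OF \<open>C \<union> D \<subseteq> U\<close>]] by blast
  qed
  have F0: "F \<alpha> \<beta> = w Z" "F \<alpha> (sym_diff \<beta> B) = w (sym_diff Z B)" "F (sym_diff \<alpha> A) \<beta> = w (sym_diff Z A)"
    "F (sym_diff \<alpha> A) (sym_diff \<beta> B) = w (sym_diff Z (A \<union> B))"
    using F[of "{}" "{}"] F[of "{}" B] F[of A "{}"] F[of A B] A B by simp_all
  have F1: "F (sym_diff \<alpha> {x}) (sym_diff \<beta> {y}) = w (sym_diff Z {x, y})" if "x \<in> S" "y \<in> U - S" for x y
    using F[of "{x}" "{y}"] that by (simp add: insert_commute)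
  have z1: "F \<alpha> (sym_diff \<beta> {y}) = 0" if "y \<in> U - S" for y
    using zero[of "{}" "{y}"] that by simp
  have z2: "F (sym_diff \<alpha> {x}) \<beta> = 0" if "x \<in> S" for x
    using zero[of "{x}" "{}"] that by simp
  have z3: "F (sym_diff \<alpha> A) (sym_diff \<beta> {y}) = 0" if "y \<in> U - S" for y
  proof -
    have "y \<notin> A" "finite A" using that A finU SU by blast+
    then have "card (A \<union> {y}) = 3" using A(2) by simp
    then show ?thesis using zero[of A "{y}"] that A by simp
  qed
  have z4: "F (sym_diff \<alpha> {x}) (sym_diff \<beta> B) = 0" if "x \<in> S" for x
  proof -
    have "x \<notin> B" "finite B" using that B finU by blast+
    then have "card ({x} \<union> B) = 3" using B(2) by simp
    then show ?thesis using zero[of "{x}" B] that B by simp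
  qed
  show thesis
  proof (rule that[of \<alpha> "sym_diff \<alpha> A" "sym_diff \<alpha> {a}" "sym_diff \<alpha> {a'}" \<beta> "sym_diff \<beta> B" "sym_diff \<beta> {b}" "sym_diff \<beta> {b'}"])
    show "F \<alpha> \<beta> * F (sym_diff \<alpha> A) (sym_diff \<beta> B) \<noteq> F \<alpha> (sym_diff \<beta> B) * F (sym_diff \<alpha> A) \<beta>"
      using m unfolding F0 by (simp add: mult.commute)
    show "F (sym_diff \<alpha> {a}) (sym_diff \<beta> {b}) * F (sym_diff \<alpha> {a'}) (sym_diff \<beta> {b'}) \<noteq>
      F (sym_diff \<alpha> {a}) (sym_diff \<beta> {b'}) * F (sym_diff \<alpha> {a'}) (sym_diff \<beta> {b})"
      unfolding F1[OF ab(1,3)] F1[OF ab(1,4)] F1[OF ab(2,3)] F1[OF ab(2,4)] by (fact m')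
    show "sym_diff \<alpha> A \<subseteq> S" "sym_diff \<alpha> {a} \<subseteq> S" "sym_diff \<alpha> {a'} \<subseteq> S"
      "sym_diff \<beta> B \<subseteq> U - S" "sym_diff \<beta> {b} \<subseteq> U - S" "sym_diff \<beta> {b'} \<subseteq> U - S"
      using \<alpha>\<beta> A B ab by blast+
  qed (fact \<alpha>\<beta> | rule z1 z2 z3 z4, rule ab)+
qed

text \<open>A nonzero entry serves as pivot: the vanishing minors through it write every entry of
  the class as column entry times row entry divided by the pivot.\<close>

lemma parity_block_rank_le_1:
  assumes fin: "finite U" and SU: "S \<subseteq> U" and ev: "\<And>N. even_minors_vanish U S w N" and par: "parity_supported U w"
  obtains u v where "\<And>\<alpha> \<beta>. \<alpha> \<subseteq> S \<Longrightarrow> \<beta> \<subseteq> U - S \<Longrightarrow> even (card \<alpha>) = p \<Longrightarrow> w (\<alpha> \<union> \<beta>) = u \<alpha> * v \<beta>"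
proof (cases "\<exists>\<alpha> \<beta>. \<alpha> \<subseteq> S \<and> \<beta> \<subseteq> U - S \<and> even (card \<alpha>) = p \<and> w (\<alpha> \<union> \<beta>) \<noteq> 0")
  case False
  then show thesis using that[of "\<lambda>_. 0" "\<lambda>_. 0"] by auto
next
  case True
  then obtain \<alpha>0 \<beta>0 where 0: "\<alpha>0 \<subseteq> S" "\<beta>0 \<subseteq> U - S" "even (card \<alpha>0) = p" "w (\<alpha>0 \<union> \<beta>0) \<noteq> 0" by blast
  have finU: "finite X" if "X \<subseteq> U" for X using that fin finite_subset by blast
  have fin0: "finite \<alpha>0" "finite \<beta>0" using 0 SU finU by blast+
  have cu: "card (\<alpha> \<union> \<beta>) = card \<alpha> + card \<beta>" if "\<alpha> \<subseteq> S" "\<beta> \<subseteq> U - S" for \<alpha> \<beta>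
    using that SU finU by (intro card_Un_disjoint) blast+
  show thesis
  proof (rule that[of "\<lambda>\<alpha>. w (\<alpha> \<union> \<beta>0) / w (\<alpha>0 \<union> \<beta>0)" "\<lambda>\<beta>. w (\<alpha>0 \<union> \<beta>)"])
    fix \<alpha> \<beta> assume s: "\<alpha> \<subseteq> S" "\<beta> \<subseteq> U - S" and e: "even (card \<alpha>) = p"
    have fin1: "finite \<alpha>" "finite \<beta>" using s SU finU by blast+
    show "w (\<alpha> \<union> \<beta>) = w (\<alpha> \<union> \<beta>0) / w (\<alpha>0 \<union> \<beta>0) * w (\<alpha>0 \<union> \<beta>)"
    proof (cases "even (card \<beta>) = even (card \<beta>0)")
      case True
      let ?Z = "\<alpha>0 \<union> \<beta>0" and ?A = "sym_diff \<alpha>0 \<alpha>" and ?B = "sym_diff \<beta>0 \<beta>"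
      have "?Z \<subseteq> U" "?A \<subseteq> S" "?B \<subseteq> U - S" using 0 s SU by blast+
      moreover have "even (card ?A)" "even (card ?B)" using True e 0(3) fin0 fin1 by (simp_all add: even_card_sym_diff)
      ultimately have "w ?Z * w (sym_diff ?Z (?A \<union> ?B)) = w (sym_diff ?Z ?A) * w (sym_diff ?Z ?B)"
        by (intro even_minors_vanishD[OF ev[of "Suc (card ?A + card ?B)"]]) auto
      moreover have "sym_diff ?Z (?A \<union> ?B) = \<alpha> \<union> \<beta>" "sym_diff ?Z ?A = \<alpha> \<union> \<beta>0" "sym_diff ?Z ?B = \<alpha>0 \<union> \<beta>"
        using 0 s by blast+
      ultimately show ?thesis using 0(4) by (simp add: field_simps)
    next
      case False
      \<comment> \<open>Used twice, for the given row and for the pivot row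
        \<open>\<alpha>0\<close>; both sides of the factorization are then zero.\<close>
      have "w (\<alpha> \<union> \<beta>) = 0" if "\<alpha> \<subseteq> S" "even (card \<alpha>) = p" for \<alpha>
      proof (rule ccontr)
        assume nz: "w (\<alpha> \<union> \<beta>) \<noteq> 0"
        have "\<alpha> \<union> \<beta> \<subseteq> U" "\<alpha>0 \<union> \<beta>0 \<subseteq> U" using that s 0 SU by blast+
        then have "even (card (\<alpha> \<union> \<beta>)) = even (card (\<alpha>0 \<union> \<beta>0))"
          using par nz 0(4) unfolding parity_supported_def by blast
        then show False using False that(2) 0(3) unfolding cu[OF that(1) s(2)] cu[OF 0(1,2)] by auto
      qed
      then show ?thesis using s e 0 by simp
    qed
  qed
qed

lemma signature_rank_le_2:
  assumes fin: "finite U" and SU: "S \<subseteq> U" and ev: "\<And>N. even_minors_vanish U S w N" and par: "parity_supported U w"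
  obtains u1 v1 u2 v2 where
    "\<And>\<alpha> \<beta>. \<alpha> \<subseteq> S \<Longrightarrow> \<beta> \<subseteq> U - S \<Longrightarrow> w (\<alpha> \<union> \<beta>) = u1 \<alpha> * v1 \<beta> + u2 \<alpha> * v2 \<beta>"
proof -
  obtain u v where uv: "\<And>\<alpha> \<beta>. \<alpha> \<subseteq> S \<Longrightarrow> \<beta> \<subseteq> U - S \<Longrightarrow> even (card \<alpha>) = True \<Longrightarrow> w (\<alpha> \<union> \<beta>) = u \<alpha> * v \<beta>"
    using parity_block_rank_le_1[OF assms, of True] by blast
  obtain u' v' where uv': "\<And>\<alpha> \<beta>. \<alpha> \<subseteq> S \<Longrightarrow> \<beta> \<subseteq> U - S \<Longrightarrow> even (card \<alpha>) = False \<Longrightarrow> w (\<alpha> \<union> \<beta>) = u' \<alpha> * v' \<beta>"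
    using parity_block_rank_le_1[OF assms, of False] by blast
  show thesis
    by (rule that[of "\<lambda>\<alpha>. if even (card \<alpha>) then u \<alpha> else 0" v "\<lambda>\<alpha>. if even (card \<alpha>) then 0 else u' \<alpha>" v'])
      (auto simp: uv uv')
qed

section \<open>Crossing paths in a disc\<close>

text \<open>In terms of the half-sum \<open>m\<close> and half-difference \<open>d\<close> of the
  angles, the sum of the points is \<open>cis m\<close> times a real number and their difference is
  \<open>cis m\<close> times an imaginary one, so the transform of a boundary point is real.\<close>

lemma cayley_on_circle:
  assumes "\<phi> - 2 * pi < \<theta>" "\<theta> < \<phi>" "R > 0"
  shows "\<i> * (of_real R * cis \<phi> + of_real R * cis \<theta>) / (of_real R * cis \<phi> - of_real R * cis \<theta>) =
    of_real (- cot ((\<theta> - \<phi>) / 2))"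
proof -
  define d where "d = (\<theta> - \<phi>) / 2"
  define m where "m = (\<theta> + \<phi>) / 2"
  have e: "\<phi> = m - d" "\<theta> = m + d" by (simp_all add: d_def m_def field_simps)
  have "sin (- d) > 0" by (rule sin_gt_zero) (use assms in \<open>simp_all add: d_def field_simps\<close>)
  then have s: "sin d \<noteq> 0" by simp
  have 1: "of_real R * cis \<phi> + of_real R * cis \<theta> = of_real R * cis m * (2 * of_real (cos d))"
    by (simp add: complex_eq_iff e cos_add cos_diff sin_add sin_diff algebra_simps)
  have 2: "of_real R * cis \<phi> - of_real R * cis \<theta> = of_real R * cis m * (- 2 * \<i> * of_real (sin d))"
    by (simp add: complex_eq_iff e cos_add cos_diff sin_add sin_diff algebra_simps)
  have "cis m \<noteq> 0" by simp
  then show ?thesis unfolding 1 2 d_def[symmetric] using s \<open>R > 0\<close>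
    by (simp add: cot_def field_simps)
qed

text \<open>This carries the order of the angles in the window of length \<open>2 * pi\<close> below
  \<open>\<phi>\<close> over to the real line.\<close>

lemma minus_cot_strict_mono:
  assumes "- pi < x" "x < y" "y < 0"
  shows "- cot x < - cot (y::real)"
proof -
  have s: "sin (- x) > 0" "sin (- y) > 0" "sin (y - x) > 0" using assms by (intro sin_gt_zero; simp)+
  then have "sin x \<noteq> 0" "sin y \<noteq> 0" by auto
  then have "cot x - cot y = sin (y - x) / (sin x * sin y)"
    by (simp add: cot_def sin_diff field_simps)
  moreover have "sin x * sin y > 0" using s by (simp add: mult_neg_neg)
  ultimately show ?thesis using s by (smt (verit) divide_pos_pos)
qed

text \<open>The imaginary part is the difference of the squared moduli of \<open>P\<close> and
  \<open>z\<close> divided by a square, so the disc lands in the closed upper half-plane.\<close>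

lemma cayley_Im_nonneg:
  fixes z P :: complex
  assumes "cmod z \<le> cmod P" "z \<noteq> P"
  shows "Im (\<i> * (P + z) / (P - z)) \<ge> 0"
proof -
  have "Im (\<i> * (P + z) / (P - z)) = Re ((P + z) / (P - z))"
    by (simp only: times_divide_eq_right[symmetric] Im_i_times)
  also have "\<dots> = (Re (P + z) * Re (P - z) + Im (P + z) * Im (P - z)) / (cmod (P - z))\<^sup>2"
    by (simp add: Re_divide cmod_power2)
  also have "Re (P + z) * Re (P - z) + Im (P + z) * Im (P - z) = (cmod P)\<^sup>2 - (cmod z)\<^sup>2"
    by (simp only: cmod_power2) (simp add: algebra_simps power2_eq_square)
  finally show ?thesis using assms by (simp add: power_mono)
qed

text \<open>A Cayley transform sends the disc without a point of its boundary to a half-plane, where the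
  Fashoda meet theorem applies.\<close>

lemma interlaced_paths_in_disc_meet:
  fixes f g :: "real \<Rightarrow> complex"
  assumes R: "R > 0" and pf: "path f" "path g"
    and im: "path_image f \<subseteq> cball 0 R" "path_image g \<subseteq> cball 0 R"
    and P: "of_real R * cis \<phi> \<notin> path_image f" "of_real R * cis \<phi> \<notin> path_image g"
    and ends: "pathstart f = of_real R * cis \<theta>1" "pathstart g = of_real R * cis \<theta>2"
      "pathfinish f = of_real R * cis \<theta>3" "pathfinish g = of_real R * cis \<theta>4"
    and ord: "\<phi> - 2 * pi < \<theta>1" "\<theta>1 < \<theta>2" "\<theta>2 < \<theta>3" "\<theta>3 < \<theta>4" "\<theta>4 < \<phi>"
  shows "path_image f \<inter> path_image g \<noteq> {}"
proof -
  define P where "P = of_real R * cis \<phi>"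
  define h where "h z = \<i> * (P + z) / (P - z)" for z
  \<comment> \<open>Copies complex numbers into the two-dimensional vector type of
    \<open>fashoda_interlace\<close>.\<close>
  define V where "V z = Re z *\<^sub>R axis 1 1 + Im z *\<^sub>R (axis 2 1 :: (real, 2) Finite_Cartesian_Product.vec)" for z
  have P0: "P \<noteq> 0" "cmod P = R" using R by (auto simp: P_def norm_mult)
  have Pim: "P \<notin> path_image f" "P \<notin> path_image g" using assms(6,7) by (simp_all add: P_def)
  have V: "vec_nth (V z) 1 = Re z" "vec_nth (V z) 2 = Im z" for z by (simp_all add: V_def axis_def)
  have Vinj: "V z = V z' \<Longrightarrow> z = z'" for z z' by (metis V complex_eqI)
  have contV: "continuous_on X V" for X
    unfolding V_def by (intro continuous_intros)
  have conth: "continuous_on (path_image F) h" if "P \<notin> path_image F" for F :: "real \<Rightarrow> complex"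
    unfolding h_def using that by (intro continuous_intros) auto
  have path: "path (V \<circ> h \<circ> F)" if "path F" "P \<notin> path_image F" for F
    unfolding comp_assoc[of V h F]
    by (rule path_continuous_image[OF path_continuous_image[OF that(1) conth[OF that(2)]] contV])
  have hI: "Im (h z) \<ge> 0" if "z \<in> cball 0 R" "z \<noteq> P" for z
    unfolding h_def using cayley_Im_nonneg[of z P] that P0 by simp
  have "compact (h ` path_image f \<union> h ` path_image g)"
    using pf by (intro compact_Un compact_continuous_image conth Pim compact_path_image) auto
  then obtain B where B: "\<And>z. z \<in> h ` path_image f \<union> h ` path_image g \<Longrightarrow> cmod z \<le> B"
    using compact_imp_bounded bounded_iff by metis
  \<comment> \<open>Both images lie above the real axis, so the box can have its bottom edge on that
    axis. The four end points are real and thus lie on this edge.\<close>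
  let ?a = "vector [- B, 0] :: (real, 2) Finite_Cartesian_Product.vec" and ?b = "vector [B, B] :: (real, 2) Finite_Cartesian_Product.vec"
  have box: "path_image (V \<circ> h \<circ> F) \<subseteq> cbox ?a ?b"
    if "F = f \<or> F = g" for F
  proof
    fix x assume "x \<in> path_image (V \<circ> h \<circ> F)"
    then obtain z where z: "z \<in> path_image F" "x = V (h z)" by (auto simp: path_image_def)
    have "cmod (h z) \<le> B" using that z B by blast
    moreover have "Im (h z) \<ge> 0" using that z im Pim by (intro hI) auto
    ultimately show "x \<in> cbox ?a ?b" 
      using abs_Re_le_cmod[of "h z"] abs_Im_le_cmod[of "h z"] by (auto simp: mem_box_cart forall_2 z V)
  qed
  have end_val: "h (of_real R * cis \<theta>) = of_real (- cot ((\<theta> - \<phi>) / 2))" if "\<phi> - 2 * pi < \<theta>" "\<theta> < \<phi>" for \<theta>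
    unfolding h_def P_def by (rule cayley_on_circle[OF that R])
  have st: "pathstart (V \<circ> h \<circ> F) = V (h (pathstart F))" "pathfinish (V \<circ> h \<circ> F) = V (h (pathfinish F))" for F
    by (simp_all add: pathstart_def pathfinish_def)
  have mono: "- cot ((s - \<phi>) / 2) < - cot ((t - \<phi>) / 2)" if "\<phi> - 2 * pi < s" "s < t" "t < \<phi>" for s t
    using that by (intro minus_cot_strict_mono) auto
  obtain z where "z \<in> path_image (V \<circ> h \<circ> f)" "z \<in> path_image (V \<circ> h \<circ> g)"
  proof (rule fashoda_interlace[OF path[OF pf(1) Pim(1)] path[OF pf(2) Pim(2)] box[of f] box[of g]])
    show "vec_nth (pathstart (V \<circ> h \<circ> f)) 1 < vec_nth (pathstart (V \<circ> h \<circ> g)) 1"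
      "vec_nth (pathstart (V \<circ> h \<circ> g)) 1 < vec_nth (pathfinish (V \<circ> h \<circ> f)) 1"
      "vec_nth (pathfinish (V \<circ> h \<circ> f)) 1 < vec_nth (pathfinish (V \<circ> h \<circ> g)) 1"
      unfolding st V ends using ord by (subst (1 2) end_val; simp; fail | use mono in auto)+
  qed (use ord in \<open>auto simp: st V ends end_val\<close>)
  then obtain x y where xy: "x \<in> path_image f" "y \<in> path_image g" "V (h x) = V (h y)"
    by (auto simp: path_image_def)
  then have "h x = h y" "x \<noteq> P" "y \<noteq> P" using Vinj Pim by auto
  \<comment> \<open>The Cayley transform is injective away from its pole, so a common point of the
    images comes from a common point of the paths.\<close>
  then have "(P + x) * (P - y) = (P + y) * (P - x)" by (simp add: h_def field_simps)
  then have "2 * P * (x - y) = 0" by (simp add: algebra_simps)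
  then show ?thesis using P0 xy by auto
qed

text \<open>Prolonged by the arcs from the outputs to the circle, the two connections become paths
  in the disc with interlaced ends, which must meet. But the arcs are pairwise disjoint and touch
  the drawing only at their own outputs, and the connections run in disjoint parts of the
  drawing.\<close>

lemma linked_outputs_do_not_cross:
  assumes ccw: "outputs_ccw_on_outer_face H p c"
    and m: "i < a" "a < j" "j < b" "b < length (outputs H)"
    and AB: "A \<subseteq> drawing_set H p c" "B \<subseteq> drawing_set H p c" "A \<inter> B = {}"
    and pA: "path_component A (p (outputs H ! i)) (p (outputs H ! j))"
    and pB: "path_component B (p (outputs H ! a)) (p (outputs H ! b))"
  shows False
proof -
  define D where "D = drawing_set H p c"
  define q where "q x = p (outputs H ! x)" for x
  obtain R :: real and \<theta> :: "nat \<Rightarrow> real" and \<gamma> :: "nat \<Rightarrow> real \<Rightarrow> complex" where DR: "D \<subseteq> ball 0 R"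
    and "\<forall>x<length (outputs H). arc (\<gamma> x) \<and> pathstart (\<gamma> x) = q x \<and>
              pathfinish (\<gamma> x) = of_real R * cis (\<theta> x) \<and>
              path_image (\<gamma> x) - {pathstart (\<gamma> x), pathfinish (\<gamma> x)} \<subseteq> outside D \<inter> ball 0 R"
    and "\<forall>x<length (outputs H). \<forall>y<length (outputs H). x \<noteq> y \<longrightarrow> path_image (\<gamma> x) \<inter> path_image (\<gamma> y) = {}"
    and "\<forall>x y. x < y \<and> y < length (outputs H) \<longrightarrow> \<theta> x < \<theta> y \<and> \<theta> y < \<theta> x + 2 * pi"
    using ccw unfolding outputs_ccw_on_outer_face_def Let_def D_def[symmetric] q_def[symmetric]
    by (elim conjE exE) (rule that; assumption)
  then have \<gamma>: "\<And>x. x < length (outputs H) \<Longrightarrow> arc (\<gamma> x) \<and> pathstart (\<gamma> x) = q x \<and>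
              pathfinish (\<gamma> x) = of_real R * cis (\<theta> x) \<and>
              path_image (\<gamma> x) - {pathstart (\<gamma> x), pathfinish (\<gamma> x)} \<subseteq> outside D \<inter> ball 0 R"
    and disj: "\<And>x y. x < length (outputs H) \<Longrightarrow> y < length (outputs H) \<Longrightarrow> x \<noteq> y \<Longrightarrow> path_image (\<gamma> x) \<inter> path_image (\<gamma> y) = {}"
    and \<theta>: "\<And>x y. x < y \<Longrightarrow> y < length (outputs H) \<Longrightarrow> \<theta> x < \<theta> y \<and> \<theta> y < \<theta> x + 2 * pi"
    by blast+
  have AD: "A \<subseteq> D" "B \<subseteq> D" using AB by (simp_all add: D_def)
  obtain f where f: "path f" "path_image f \<subseteq> A" "pathstart f = q i" "pathfinish f = q j"
    using pA unfolding path_component_def q_def by blast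
  obtain g where g: "path g" "path_image g \<subseteq> B" "pathstart g = q a" "pathfinish g = q b"
    using pB unfolding path_component_def q_def by blast
  have "q i \<in> D" using f AB pathstart_in_path_image[of f] by (auto simp: D_def)
  then have "R > 0" using DR by (metis empty_iff ball_empty linorder_not_less subset_iff)
  let ?F = "reversepath (\<gamma> i) +++ f +++ \<gamma> j" and ?G = "reversepath (\<gamma> a) +++ g +++ \<gamma> b"
  let ?e = "\<lambda>x. of_real R * cis (\<theta> x) :: complex"
  have lt: "i < length (outputs H)" "a < length (outputs H)" "j < length (outputs H)" "b < length (outputs H)" using m by auto
  note G = \<gamma>[OF lt(1)] \<gamma>[OF lt(2)] \<gamma>[OF lt(3)] \<gamma>[OF lt(4)]
  have imF: "path_image ?F = path_image (\<gamma> i) \<union> path_image f \<union> path_image (\<gamma> j)"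
    using G f by (simp add: path_image_join Un_assoc)
  have imG: "path_image ?G = path_image (\<gamma> a) \<union> path_image g \<union> path_image (\<gamma> b)"
    using G g by (simp add: path_image_join Un_assoc)
  have \<gamma>D: "path_image (\<gamma> x) \<inter> D = {q x}" "path_image (\<gamma> x) \<subseteq> insert (?e x) (ball 0 R)"
    if "x < length (outputs H)" "q x \<in> D" for x
  proof -
    have "?e x \<notin> D" using DR \<open>R > 0\<close> by (auto simp: norm_mult)
    moreover have "outside D \<inter> D = {}" using outside_no_overlap[of D] by blast
    moreover have "q x \<in> path_image (\<gamma> x)" "path_image (\<gamma> x) - {q x, ?e x} \<subseteq> outside D"
      "path_image (\<gamma> x) - {q x, ?e x} \<subseteq> ball 0 R"
      using \<gamma>[OF that(1)] pathstart_in_path_image[of "\<gamma> x"] by (metis le_inf_iff)+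
    ultimately show "path_image (\<gamma> x) \<inter> D = {q x}" "path_image (\<gamma> x) \<subseteq> insert (?e x) (ball 0 R)"
      using that(2) DR by blast+
  qed
  have qD: "q i \<in> A" "q j \<in> A" "q a \<in> B" "q b \<in> B"
    using f g pathstart_in_path_image[of f] pathfinish_in_path_image[of f]
      pathstart_in_path_image[of g] pathfinish_in_path_image[of g] by auto
  have qD': "q i \<in> D" "q j \<in> D" "q a \<in> D" "q b \<in> D" using qD AB by (auto simp: D_def)
  note \<gamma>' = \<gamma>D[OF lt(1) qD'(1)] \<gamma>D[OF lt(2) qD'(3)] \<gamma>D[OF lt(3) qD'(2)] \<gamma>D[OF lt(4) qD'(4)]
  have fg: "path_image f \<subseteq> D" "path_image g \<subseteq> D" using f g AB by (auto simp: D_def)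
  \<comment> \<open>The middle of the gap between \<open>\<theta> b\<close> and the next turn of
    \<open>\<theta> i\<close>: a boundary point missed by both paths, which becomes the pole of the
    Cayley transform.\<close>
  define \<phi> where "\<phi> = (\<theta> b + \<theta> i + 2 * pi) / 2"
  have ord: "\<theta> i < \<theta> a" "\<theta> a < \<theta> j" "\<theta> j < \<theta> b" "\<theta> b < \<theta> i + 2 * pi"
    using \<theta>[of i a] \<theta>[of a j] \<theta>[of j b] \<theta>[of i b] m by auto
  then have ord': "\<phi> - 2 * pi < \<theta> i" "\<theta> b < \<phi>" by (auto simp: \<phi>_def)
  \<comment> \<open>Half the angle between the two points lies strictly between 0 and
    \<open>pi\<close>, where the sine is positive.\<close>
  have ne: "of_real R * cis \<phi> \<noteq> ?e x" if "x \<in> {i, a, j, b}" for x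
  proof
    assume "of_real R * cis \<phi> = ?e x"
    then have "cis \<phi> = cis (\<theta> x)" using \<open>R > 0\<close> by simp
    then have "cis (\<phi> - \<theta> x) = 1" by (simp add: cis_divide[symmetric])
    then have "cos (\<phi> - \<theta> x) = 1" by (simp add: complex_eq_iff)
    moreover have "cos (\<phi> - \<theta> x) = 1 - 2 * (sin ((\<phi> - \<theta> x) / 2))\<^sup>2"
      using cos_double_sin[of "(\<phi> - \<theta> x) / 2"] by (simp only: times_divide_eq_right nonzero_mult_div_cancel_left)
    ultimately have "sin ((\<phi> - \<theta> x) / 2) = 0" by simp
    moreover have "sin ((\<phi> - \<theta> x) / 2) > 0" using that ord ord' by (intro sin_gt_zero) auto
    ultimately show False by simp
  qed
  have nb: "of_real R * cis \<phi> \<notin> ball 0 R" using \<open>R > 0\<close> by (simp add: norm_mult)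
  have eb: "?e x \<in> cball 0 R" for x using \<open>R > 0\<close> by (simp add: norm_mult)
  have sF: "path_image ?F \<subseteq> {?e i, ?e j} \<union> ball 0 R" unfolding imF using \<gamma>' fg DR by blast
  have sG: "path_image ?G \<subseteq> {?e a, ?e b} \<union> ball 0 R" unfolding imG using \<gamma>' fg DR by blast
  have "path_image ?F \<inter> path_image ?G \<noteq> {}"
  proof (rule interlaced_paths_in_disc_meet[OF \<open>R > 0\<close>])
    show "path ?F" "path ?G" using G f g by (simp_all add: arc_imp_path)
    show "path_image ?F \<subseteq> cball 0 R" using sF eb ball_subset_cball by blast
    show "path_image ?G \<subseteq> cball 0 R" using sG eb ball_subset_cball by blast
    show "of_real R * cis \<phi> \<notin> path_image ?F" using sF nb ne by blast
    show "of_real R * cis \<phi> \<notin> path_image ?G" using sG nb ne by blast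
  qed (use G f g ord ord' in auto)
  moreover have "path_image (\<gamma> x) \<inter> path_image (\<gamma> y) = {}" if "x \<in> {i, j}" "y \<in> {a, b}" for x y
    using disj[of x y] that m by auto
  moreover have "path_image f \<inter> path_image g = {}" using f g AB by blast
  moreover have "path_image f \<inter> path_image (\<gamma> y) = {}" if "y \<in> {a, b}" for y
  proof -
    have "y < length (outputs H)" "q y \<in> B" using that lt qD by auto
    then have y: "path_image (\<gamma> y) \<inter> D = {q y}" using \<gamma>D(1) AD by blast
    have "path_image f \<inter> path_image (\<gamma> y) \<subseteq> A \<inter> (path_image (\<gamma> y) \<inter> D)" using f(2) fg(1) by blast
    then show ?thesis unfolding y using AB(3) \<open>q y \<in> B\<close> by auto
  qed
  moreover have "path_image (\<gamma> x) \<inter> path_image g = {}" if "x \<in> {i, j}" for x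
  proof -
    have "x < length (outputs H)" "q x \<in> A" using that lt qD by auto
    then have x: "path_image (\<gamma> x) \<inter> D = {q x}" using \<gamma>D(1) AD by blast
    have "path_image (\<gamma> x) \<inter> path_image g \<subseteq> B \<inter> (path_image (\<gamma> x) \<inter> D)" using g(2) fg(2) by blast
    then show ?thesis unfolding x using AB(3) \<open>q x \<in> A\<close> by auto
  qed
  ultimately show False unfolding imF imG Int_Un_distrib Int_Un_distrib2 by simp
qed

section \<open>Components of unions of matchings\<close>

definition component :: "'a set set \<Rightarrow> 'a \<Rightarrow> 'a set" where
  "component N u = {(x, y). \<exists>e\<in>N. x \<in> e \<and> y \<in> e}\<^sup>* `` {u}"

definition edge_degree :: "'a set set \<Rightarrow> 'a \<Rightarrow> nat" where
  "edge_degree N v = card {e \<in> N. v \<in> e}"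

lemma component_refl [simp]: "u \<in> component N u"
  by (simp add: component_def)

lemma component_eq: "v \<in> component N u \<Longrightarrow> component N v = component N u"
proof -
  let ?r = "{(x, y). \<exists>e\<in>N. x \<in> e \<and> y \<in> e}"
  assume "v \<in> component N u"
  moreover have "sym ?r" by (auto simp: sym_def)
  then have "sym (?r\<^sup>*)" by (rule sym_rtrancl)
  ultimately have "(u, v) \<in> ?r\<^sup>*" "(v, u) \<in> ?r\<^sup>*" by (auto simp: component_def dest: symD)
  then have "(v, x) \<in> ?r\<^sup>* \<longleftrightarrow> (u, x) \<in> ?r\<^sup>*" for x by (meson rtrancl_trans)
  then show ?thesis by (simp add: component_def set_eq_iff)
qed

lemma component_disjoint: "component N u = component N v \<or> component N u \<inter> component N v = {}"
  by (metis component_eq disjoint_iff)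

lemma edge_in_component:
  assumes "e \<in> N" "x \<in> e" "x \<in> component N u"
  shows "e \<subseteq> component N u"
proof
  fix y assume "y \<in> e"
  with assms(1,2) have "(x, y) \<in> {(x, y). \<exists>e\<in>N. x \<in> e \<and> y \<in> e}" by blast
  with assms(3) show "y \<in> component N u"
    unfolding component_def by (auto intro: rtrancl_into_rtrancl)
qed

lemma component_subset: "component N u \<subseteq> insert u (\<Union>N)"
proof
  fix v assume "v \<in> component N u"
  then have "(u, v) \<in> {(x, y). \<exists>e\<in>N. x \<in> e \<and> y \<in> e}\<^sup>*" by (simp add: component_def)
  then show "v \<in> insert u (\<Union>N)" by (induction rule: rtrancl_induct) auto
qed

lemma component_minimal:
  assumes "u \<in> S" and "\<And>e x. e \<in> N \<Longrightarrow> x \<in> e \<Longrightarrow> x \<in> S \<Longrightarrow> e \<subseteq> S"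
  shows "component N u \<subseteq> S"
proof
  fix v assume "v \<in> component N u"
  then have "(u, v) \<in> {(x, y). \<exists>e\<in>N. x \<in> e \<and> y \<in> e}\<^sup>*" by (simp add: component_def)
  then show "v \<in> S" by (induction rule: rtrancl_induct) (use assms in blast)+
qed

text \<open>The tree bound for connected graphs. A largest set of vertices that contains
  \<open>u\<close> and obeys the bound is closed under edges, because an edge leaving it would bring
  in one new vertex and at least one new edge.\<close>

lemma card_component_le:
  assumes fin: "finite N" and two: "\<And>e. e \<in> N \<Longrightarrow> card e = 2"
  shows "card (component N u) \<le> card {e \<in> N. e \<subseteq> component N u} + 1"
proof -
  let ?K = "component N u"
  have "finite e" if "e \<in> N" for e using two[OF that] by (metis card.infinite zero_neq_numeral)
  then have finK: "finite ?K" using component_subset[of N u] fin by (meson finite_Union finite_insert finite_subset)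
  let ?good = "\<lambda>S. u \<in> S \<and> S \<subseteq> ?K \<and> card S \<le> card {e \<in> N. e \<subseteq> S} + 1"
  have "?good {u}" by simp
  moreover have "\<forall>S. ?good S \<longrightarrow> card S < Suc (card ?K)" using card_mono[OF finK] le_imp_less_Suc by blast
  ultimately have "\<exists>S. ?good S \<and> (\<forall>T. ?good T \<longrightarrow> card T \<le> card S)" by (rule ex_has_greatest_nat)
  then obtain S where S: "?good S" and max: "\<And>T. ?good T \<Longrightarrow> card T \<le> card S" by blast
  have finS: "finite S" using S finK finite_subset by blast
  have "?K \<subseteq> S"
  proof (rule component_minimal, rule conjunct1[OF S], rule ccontr)
    fix e x assume e: "e \<in> N" "x \<in> e" "x \<in> S" "\<not> e \<subseteq> S"
    then obtain y where y: "y \<in> e" "y \<notin> S" by blast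
    have exy: "e = {x, y}"
      using e y two[OF e(1)] by (auto simp: card_2_iff)
    have "y \<in> ?K" using edge_in_component[OF e(1,2)] S e y by blast
    have "e \<subseteq> insert y S" using exy e(3) by simp
    then have "{e \<in> N. e \<subseteq> S} \<subset> {e \<in> N. e \<subseteq> insert y S}" using e(1,4) by blast
    then have "card {e \<in> N. e \<subseteq> S} < card {e \<in> N. e \<subseteq> insert y S}" using fin by (intro psubset_card_mono) auto
    then have "card (insert y S) \<le> card {e \<in> N. e \<subseteq> insert y S} + 1" using S finS y(2) by simp
    then have "?good (insert y S)" using S \<open>y \<in> ?K\<close> by blast
    then show False using max[of "insert y S"] finS y by simp
  qed
  with S have "S = ?K" by blast
  with S show ?thesis by simp
qed

lemma handshake:
  assumes "finite N" "finite K" and "\<And>e. e \<in> N \<Longrightarrow> card e = 2" and "\<And>e. e \<in> N \<Longrightarrow> e \<subseteq> K \<or> e \<inter> K = {}"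
  shows "(\<Sum>v\<in>K. edge_degree N v) = 2 * card {e \<in> N. e \<subseteq> K}"
proof -
  have "\<forall>e\<in>N. card {v \<in> K. v \<in> e} = 2 * of_bool (e \<subseteq> K)"
  proof
    fix e assume e: "e \<in> N"
    show "card {v \<in> K. v \<in> e} = 2 * of_bool (e \<subseteq> K)"
    proof (cases "e \<subseteq> K")
      case True
      then have "{v \<in> K. v \<in> e} = e" by blast
      then show ?thesis using True assms(3)[OF e] by simp
    next
      case False
      then have empty: "{v \<in> K. v \<in> e} = {}" using assms(4)[OF e] by blast
      show ?thesis unfolding empty using False by simp
    qed
  qed
  then have "(\<Sum>v\<in>K. edge_degree N v) = (\<Sum>e\<in>N. 2 * of_bool (e \<subseteq> K))"
    unfolding edge_degree_def by (rule sum_multicount_gen[OF assms(2,1)])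
  also have "\<dots> = 2 * card {e \<in> N. e \<subseteq> K}" using assms(1) by (simp add: sum_distrib_left[symmetric] Int_def)
  finally show ?thesis .
qed

text \<open>The component is a path or a cycle, but counting avoids describing it. A degree plus 1
  for being odd is at most 2 per vertex, so \<open>d + 2 * (f1 + f2) \<le> 2 * card K\<close>, while
  the tree bound gives \<open>card K \<le> f1 + f2 + 1\<close>. Degrees are added rather than taken
  in the union, so an edge shared by both sets counts twice.\<close>

lemma odd_vertices_of_component:
  fixes N1 N2 :: "'a set set" and u :: 'a
  defines "K \<equiv> component (N1 \<union> N2) u"
  assumes fin: "finite N1" "finite N2" and two: "\<And>e. e \<in> N1 \<union> N2 \<Longrightarrow> card e = 2"
    and deg: "\<And>v. v \<in> K \<Longrightarrow> edge_degree N1 v + edge_degree N2 v \<le> 2"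
  shows "card {v \<in> K. odd (edge_degree N1 v + edge_degree N2 v)} \<le> 2"
    "even (card {v \<in> K. odd (edge_degree N1 v + edge_degree N2 v)})"
proof -
  let ?d = "\<lambda>v. edge_degree N1 v + edge_degree N2 v" and ?O = "{v \<in> K. odd (edge_degree N1 v + edge_degree N2 v)}"
  have "finite e" if "e \<in> N1 \<union> N2" for e using two[OF that] by (metis card.infinite zero_neq_numeral)
  then have finK: "finite K"
    using component_subset[of "N1 \<union> N2" u] fin unfolding K_def by (meson finite_Union finite_UnI finite_insert finite_subset)
  have "e \<subseteq> K \<or> e \<inter> K = {}" if "e \<in> N1 \<union> N2" for e
    using edge_in_component[OF that] unfolding K_def by blast
  then have sum: "(\<Sum>v\<in>K. ?d v) = 2 * (card {e \<in> N1. e \<subseteq> K} + card {e \<in> N2. e \<subseteq> K})"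
    unfolding sum.distrib using fin finK two by (subst (1 2) handshake) auto
  have "even (\<Sum>v\<in>K. ?d v)" unfolding sum by (rule dvd_triv_left)
  then show "even (card ?O)" using even_sum_iff[OF finK, of ?d] by blast
  define f1 f2 f d where "f1 = card {e \<in> N1. e \<subseteq> K}" and "f2 = card {e \<in> N2. e \<subseteq> K}"
    and "f = card {e \<in> N1 \<union> N2. e \<subseteq> K}" and "d = card ?O"
  have "{e \<in> N1 \<union> N2. e \<subseteq> K} = {e \<in> N1. e \<subseteq> K} \<union> {e \<in> N2. e \<subseteq> K}" by blast
  then have "f \<le> f1 + f2" unfolding f1_def f2_def f_def by (simp add: card_Un_le)
  moreover have "card K \<le> f + 1"
    unfolding K_def f_def using fin two by (intro card_component_le) auto
  moreover have "d + 2 * (f1 + f2) \<le> 2 * card K"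
  proof -
    have "(\<Sum>v\<in>K. of_bool (odd (?d v)) + ?d v) \<le> (\<Sum>v\<in>K. 2)"
    proof (rule sum_mono)
      fix v assume "v \<in> K"
      then have "?d v \<le> 2" by (rule deg)
      then show "of_bool (odd (?d v)) + ?d v \<le> 2" by (cases "?d v = 2") auto
    qed
    moreover have "(\<Sum>v\<in>K. of_bool (odd (?d v)) + ?d v) = (\<Sum>v\<in>K. of_bool (odd (?d v))) + (\<Sum>v\<in>K. ?d v)"
      by (rule sum.distrib)
    moreover have "(\<Sum>v\<in>K. of_bool (odd (?d v))) = d" unfolding d_def using finK by (simp add: Int_def)
    ultimately show ?thesis unfolding sum f1_def f2_def by simp
  qed
  ultimately have "d \<le> 2" by presburger
  then show "card ?O \<le> 2" by (simp only: d_def)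
qed

lemma even_card_involution:
  assumes "finite A" "\<And>x. x \<in> A \<Longrightarrow> f x \<in> A \<and> f x \<noteq> x \<and> f (f x) = x"
  shows "even (card A)"
  using assms
proof (induction "card A" arbitrary: A rule: less_induct)
  case less
  show ?case
  proof (cases "A = {}")
    case False
    then obtain x where x: "x \<in> A" by blast
    let ?B = "A - {x, f x}"
    have fx: "f x \<in> A" "f x \<noteq> x" "f (f x) = x" using less.prems(2)[OF x] by auto
    have c: "card ?B = card A - 2" using x fx less.prems(1) by (simp add: card_Diff_subset)
    have "card {x, f x} \<le> card A" using x fx less.prems(1) by (intro card_mono) auto
    then have "card A \<ge> 2" using fx by simp
    have "even (card ?B)"
    proof (rule less.hyps)
      show "card ?B < card A" using c \<open>card A \<ge> 2\<close> by simp
      show "finite ?B" using less.prems by simp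
      fix y assume "y \<in> ?B"
      then show "f y \<in> ?B \<and> f y \<noteq> y \<and> f (f y) = y"
        using less.prems(2)[of y] fx by auto
    qed
    then show ?thesis using c \<open>card A \<ge> 2\<close> by simp
  qed simp
qed

section \<open>Signatures of plane gates\<close>

lemma ex1_iff_singleton: "(\<exists>!x. P x) \<longleftrightarrow> (\<exists>a. {x. P x} = {a})"
proof
  assume "\<exists>!x. P x"
  then obtain a where "P a" "\<And>y. P y \<Longrightarrow> y = a" by blast
  then have "{x. P x} = {a}" by blast
  then show "\<exists>a. {x. P x} = {a}" ..
next
  assume "\<exists>a. {x. P x} = {a}"
  then obtain a where "{x. P x} = {a}" ..
  then have "P x \<longleftrightarrow> x = a" for x by (simp add: set_eq_iff)
  then show "\<exists>!x. P x" by simp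
qed

text \<open>When \<open>K\<close> is a component of \<open>N1 \<union> N2\<close>, every edge lies
  inside or outside \<open>K\<close>, and this is \<open>N1\<close> with its part inside
  \<open>K\<close> replaced by that of \<open>N2\<close>.\<close>

definition swap_on :: "'a set \<Rightarrow> 'a set set \<Rightarrow> 'a set set \<Rightarrow> 'a set set" where
  "swap_on K N1 N2 = {e \<in> N1. e \<inter> K = {}} \<union> {e \<in> N2. e \<inter> K \<noteq> {}}"

lemma swap_on_Un: "swap_on K N1 N2 \<union> swap_on K N2 N1 = N1 \<union> N2"
  by (auto simp: swap_on_def)

lemma swap_on_swap_on: "swap_on K (swap_on K N1 N2) (swap_on K N2 N1) = N1"
  by (auto simp: swap_on_def)

lemma edge_degree_swap_on:
  assumes "\<And>e. e \<in> N1 \<union> N2 \<Longrightarrow> e \<subseteq> K \<or> e \<inter> K = {}"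
  shows "edge_degree (swap_on K N1 N2) v = (if v \<in> K then edge_degree N2 v else edge_degree N1 v)"
proof -
  have "{e \<in> swap_on K N1 N2. v \<in> e} = {e \<in> N2. v \<in> e}" if "v \<in> K"
    using that unfolding swap_on_def by blast
  moreover have "{e \<in> swap_on K N1 N2. v \<in> e} = {e \<in> N1. v \<in> e}" if "v \<notin> K"
    using that assms unfolding swap_on_def by blast
  ultimately show ?thesis by (simp add: edge_degree_def)
qed

text \<open>The two exchanged sets together contain the edges of \<open>N1\<close> and
  \<open>N2\<close> with the same multiplicities, so the weight of the pair is preserved.\<close>

lemma prod_swap_on:
  fixes f :: "'a set \<Rightarrow> 'b :: comm_monoid_mult"
  assumes "finite N1" "finite N2"
  shows "prod f (swap_on K N1 N2) * prod f (swap_on K N2 N1) = prod f N1 * prod f N2"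
proof -
  have split: "prod f N = prod f {e \<in> N. e \<inter> K = {}} * prod f {e \<in> N. e \<inter> K \<noteq> {}}" if "finite N" for N
  proof -
    have "N = {e \<in> N. e \<inter> K = {}} \<union> {e \<in> N. e \<inter> K \<noteq> {}}" by blast
    moreover have "prod f ({e \<in> N. e \<inter> K = {}} \<union> {e \<in> N. e \<inter> K \<noteq> {}}) =
        prod f {e \<in> N. e \<inter> K = {}} * prod f {e \<in> N. e \<inter> K \<noteq> {}}"
      using that by (intro prod.union_disjoint) auto
    ultimately show ?thesis by simp
  qed
  have sw: "prod f (swap_on K M N) = prod f {e \<in> M. e \<inter> K = {}} * prod f {e \<in> N. e \<inter> K \<noteq> {}}"
    if "finite M" "finite N" for M N
    unfolding swap_on_def using that by (intro prod.union_disjoint) auto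
  show ?thesis
    unfolding sw[OF assms] sw[OF assms(2,1)] split[OF assms(1)] split[OF assms(2)] by (simp add: ac_simps)
qed

locale drawn_gate =
  fixes H :: "'v gate" and p :: "'v \<Rightarrow> complex" and c :: "'v set \<Rightarrow> real \<Rightarrow> complex"
  assumes wf: "wf_gate H" and drawing: "plane_drawing H p c" and ccw: "outputs_ccw_on_outer_face H p c"
begin

definition out :: "nat \<Rightarrow> 'v" where "out x = outputs H ! x"

definition labels :: "nat set" where "labels = {..<length (outputs H)}"

definition matchings :: "nat set \<Rightarrow> 'v set set set" where
  "matchings X = perfect_matchings (delete_nodes H (out ` X))"

definition sig :: "nat set \<Rightarrow> complex" where
  "sig X = perf_match (delete_nodes H (out ` X))"

lemma finite_nodes: "finite (nodes H)" and edge_nodes: "e \<in> edges H \<Longrightarrow> e \<subseteq> nodes H"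
  and edge_card: "e \<in> edges H \<Longrightarrow> card e = 2" and finite_edges: "finite (edges H)"
  using wf finite_subset[of "edges H" "Pow (nodes H)"] by (auto simp: wf_gate_def)

lemma finite_labels: "finite labels" by (simp add: labels_def)

lemma out_inj: "inj_on out labels"
  using wf by (auto simp: wf_gate_def inj_on_def out_def labels_def nth_eq_iff_index_eq)

lemma out_nodes: "x \<in> labels \<Longrightarrow> out x \<in> nodes H"
  using wf by (auto simp: wf_gate_def out_def labels_def)

lemma out_image_iff: "X \<subseteq> labels \<Longrightarrow> x \<in> labels \<Longrightarrow> out x \<in> out ` X \<longleftrightarrow> x \<in> X"
  using out_inj by (auto simp: inj_on_def)

text \<open>Deleted nodes become nodes of degree 0. Matchings of different subgraphs are thereby
  edge sets of the single gate \<open>H\<close>, and overlaying or exchanging them is a computation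
  with degrees.\<close>

lemma in_matchings_iff:
  assumes "X \<subseteq> labels"
  shows "N \<in> matchings X \<longleftrightarrow> N \<subseteq> edges H \<and> (\<forall>v\<in>nodes H. edge_degree N v = of_bool (v \<notin> out ` X))"
proof -
  have fin: "finite N" if "N \<subseteq> edges H" using that finite_edges finite_subset by blast
  have Z: "out ` X \<subseteq> nodes H" using assms out_nodes by blast
  have one: "(\<exists>!e. e \<in> N \<and> v \<in> e) \<longleftrightarrow> edge_degree N v = 1" for v
  proof -
    have "(\<exists>!e. e \<in> N \<and> v \<in> e) \<longleftrightarrow> (\<exists>e. {e \<in> N. v \<in> e} = {e})" 
      by (rule ex1_iff_singleton)
    then show ?thesis unfolding edge_degree_def by (simp add: card_1_singleton_iff)
  qed
  have zero: "edge_degree N v = 0 \<longleftrightarrow> (\<forall>e\<in>N. v \<notin> e)" if "N \<subseteq> edges H" for v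
    unfolding edge_degree_def using fin[OF that] by auto
  have "N \<in> matchings X \<longleftrightarrow> N \<subseteq> edges H \<and> (\<forall>v\<in>out ` X. \<forall>e\<in>N. v \<notin> e) \<and> (\<forall>v\<in>nodes H - out ` X. edge_degree N v = 1)"
  proof -
    have "N \<in> matchings X \<longleftrightarrow> N \<subseteq> {e \<in> edges H. e \<inter> out ` X = {}} \<and> (\<forall>v\<in>nodes H - out ` X. edge_degree N v = 1)"
      unfolding matchings_def perfect_matchings_def delete_nodes_def one[symmetric] by simp
    moreover have "N \<subseteq> {e \<in> edges H. e \<inter> out ` X = {}} \<longleftrightarrow> N \<subseteq> edges H \<and> (\<forall>v\<in>out ` X. \<forall>e\<in>N. v \<notin> e)"
      by blast
    ultimately show ?thesis by (simp only: conj_assoc)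
  qed
  also have "\<dots> \<longleftrightarrow> N \<subseteq> edges H \<and> (\<forall>v\<in>nodes H. edge_degree N v = of_bool (v \<notin> out ` X))"
  proof (cases "N \<subseteq> edges H")
    case True
    have "nodes H \<inter> out ` X = out ` X" using Z by blast
    then have "(\<forall>v\<in>out ` X. \<forall>e\<in>N. v \<notin> e) \<longleftrightarrow> (\<forall>v\<in>nodes H \<inter> out ` X. edge_degree N v = 0)"
      by (simp add: zero[OF True])
    moreover have "(\<forall>v\<in>nodes H. edge_degree N v = of_bool (v \<notin> out ` X)) \<longleftrightarrow>
        (\<forall>v\<in>nodes H \<inter> out ` X. edge_degree N v = 0) \<and> (\<forall>v\<in>nodes H - out ` X. edge_degree N v = 1)"
      by fastforce
    ultimately show ?thesis by (simp only:)
  qed simp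
  finally show ?thesis .
qed

lemma sig_eq: "sig X = (\<Sum>N\<in>matchings X. \<Prod>e\<in>N. weight H e)"
  by (simp add: sig_def perf_match_def matchings_def delete_nodes_def)

lemma finite_matchings: "finite (matchings X)"
  by (rule finite_subset[of _ "Pow (edges H)"])
    (auto simp: matchings_def perfect_matchings_def delete_nodes_def finite_edges)

text \<open>A perfect matching pairs off the remaining nodes, so \<open>card X\<close> has the
  parity of \<open>card (nodes H)\<close> whenever there is one.\<close>

lemma sig_parity_supported: "parity_supported labels sig"
proof -
  have "even (card (nodes H)) = even (card X)" if X: "X \<subseteq> labels" "sig X \<noteq> 0" for X
  proof -
    obtain N where N: "N \<in> matchings X" using X(2) unfolding sig_eq by (metis sum.empty ex_in_conv)
    then have N': "N \<subseteq> edges H" "\<And>v. v \<in> nodes H \<Longrightarrow> edge_degree N v = of_bool (v \<notin> out ` X)"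
      using in_matchings_iff[OF X(1)] by blast+
    have fX: "finite X" using X(1) finite_labels finite_subset by blast
    have Xn: "out ` X \<subseteq> nodes H" using X(1) out_nodes by blast
    have "(\<Sum>v\<in>nodes H. edge_degree N v) = 2 * card {e \<in> N. e \<subseteq> nodes H}"
    proof (rule handshake)
      show "finite N" using N'(1) finite_edges finite_subset by blast
    qed (use N'(1) finite_nodes edge_card edge_nodes in blast)+
    moreover have "(\<Sum>v\<in>nodes H. edge_degree N v) = (\<Sum>v\<in>nodes H. of_bool (v \<notin> out ` X))"
      using N'(2) by (intro sum.cong) auto
    moreover have "\<dots> = card (nodes H - out ` X)"
      using finite_nodes by (simp add: Int_def set_diff_eq)
    moreover have "card (nodes H - out ` X) = card (nodes H) - card X"
      using Xn fX card_image[OF inj_on_subset[OF out_inj X(1)]] by (simp add: card_Diff_subset)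
    moreover have "card X \<le> card (nodes H)"
      using card_mono[OF finite_nodes Xn] card_image[OF inj_on_subset[OF out_inj X(1)]] by simp
    ultimately show ?thesis by presburger
  qed
  then show ?thesis unfolding parity_supported_def by blast
qed

text \<open>The multigraph union of the two matchings belonging to one summand of a matchgate identity.\<close>

definition overlay :: "nat set \<Rightarrow> 'v set set \<Rightarrow> 'v set set \<Rightarrow> bool" where
  "overlay D N1 N2 \<longleftrightarrow> D \<subseteq> labels \<and> N1 \<subseteq> edges H \<and> N2 \<subseteq> edges H \<and>
     (\<forall>v\<in>nodes H. edge_degree N1 v + edge_degree N2 v \<le> 2 \<and> (odd (edge_degree N1 v + edge_degree N2 v) \<longleftrightarrow> v \<in> out ` D))"

text \<open>The total degree of an output is odd exactly when it is deleted in one of the two graphs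
  only. The flip at \<open>i\<close> affects both and cancels, so the odd vertices are the same for
  every \<open>i\<close>.\<close>

lemma overlay_matchings:
  assumes X: "X \<subseteq> labels" and Y: "Y \<subseteq> labels" and i: "i \<in> labels"
    and N: "N1 \<in> matchings (sym_diff X {i})" "N2 \<in> matchings (sym_diff Y {i})"
  shows "overlay (sym_diff X Y) N1 N2"
proof -
  have s: "sym_diff X {i} \<subseteq> labels" "sym_diff Y {i} \<subseteq> labels" "sym_diff X Y \<subseteq> labels" using X Y i by blast+
  note m = N(1)[unfolded in_matchings_iff[OF s(1)]] N(2)[unfolded in_matchings_iff[OF s(2)]]
  have "edge_degree N1 v + edge_degree N2 v \<le> 2 \<and> (odd (edge_degree N1 v + edge_degree N2 v) \<longleftrightarrow> v \<in> out ` sym_diff X Y)"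
    if v: "v \<in> nodes H" for v
  proof -
    have d: "edge_degree N1 v = of_bool (v \<notin> out ` sym_diff X {i})" "edge_degree N2 v = of_bool (v \<notin> out ` sym_diff Y {i})"
      using m v by blast+
    show ?thesis
    proof (cases "v \<in> out ` labels")
      case True
      then obtain x where x: "x \<in> labels" "v = out x" by blast
      show ?thesis unfolding d unfolding x(2) out_image_iff[OF s(1) x(1)] out_image_iff[OF s(2) x(1)] out_image_iff[OF s(3) x(1)]
        by (cases "x = i"; cases "x \<in> X"; cases "x \<in> Y") simp_all
    next
      case False
      then have "v \<notin> out ` sym_diff X {i}" "v \<notin> out ` sym_diff Y {i}" "v \<notin> out ` sym_diff X Y" using s by blast+
      then show ?thesis unfolding d by (simp only: of_bool_def) simp
    qed
  qed
  then show ?thesis unfolding overlay_def using s(3) m by blast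
qed

text \<open>The odd vertices of the component of \<open>out x\<close> are outputs with labels in
  \<open>D\<close>. Their number is even, at most 2, and not 0.\<close>

lemma partner_ex1:
  assumes o: "overlay D N1 N2" and x: "x \<in> D"
  shows "\<exists>!y. y \<in> D \<and> y \<noteq> x \<and> out y \<in> component (N1 \<union> N2) (out x)"
proof -
  let ?K = "component (N1 \<union> N2) (out x)"
  let ?O = "{v \<in> ?K. odd (edge_degree N1 v + edge_degree N2 v)}"
  have D: "D \<subseteq> labels" and N: "N1 \<union> N2 \<subseteq> edges H" using o by (auto simp: overlay_def)
  then have "\<Union>(N1 \<union> N2) \<subseteq> nodes H" using edge_nodes by blast
  then have K: "?K \<subseteq> nodes H" using component_subset[of "N1 \<union> N2" "out x"] out_nodes[of x] D x by blast
  have fin: "finite N1" "finite N2" using N finite_edges finite_subset by blast+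
  have O: "?O = ?K \<inter> out ` D" using K o unfolding overlay_def by blast
  have "card ?O \<le> 2" "even (card ?O)"
    using o N K edge_card by (intro odd_vertices_of_component fin; auto simp: overlay_def)+
  moreover have "out x \<in> ?O" unfolding O using x by simp
  moreover have "finite ?O" unfolding O using finite_subset[OF D finite_labels] by simp
  ultimately have "card ?O = 2" by (metis card_gt_0_iff empty_iff dvd_imp_le le_antisym)
  with \<open>out x \<in> ?O\<close> obtain v where v: "?O = {out x, v}" "v \<noteq> out x"
    by (smt (verit) card_2_iff insert_commute insert_iff singleton_iff)
  then obtain y where y: "y \<in> D" "v = out y" using O by blast
  show ?thesis
  proof (rule ex1I[of _ y])
    show "y \<in> D \<and> y \<noteq> x \<and> out y \<in> ?K" using y v O by blast
    fix z assume z: "z \<in> D \<and> z \<noteq> x \<and> out z \<in> ?K"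
    then have "out z \<in> {out x, out y}" using O v y by blast
    then show "z = y" using out_inj D z x y unfolding inj_on_def by blast
  qed
qed

text \<open>It depends only on the union of the two matchings, hence survives an exchange of edges
  between them.\<close>

definition partner :: "nat set \<Rightarrow> 'v set set \<Rightarrow> nat \<Rightarrow> nat" where
  "partner D N x = (THE y. y \<in> D \<and> y \<noteq> x \<and> out y \<in> component N (out x))"

lemma partner:
  assumes "overlay D N1 N2" "x \<in> D"
  shows "partner D (N1 \<union> N2) x \<in> D" "partner D (N1 \<union> N2) x \<noteq> x"
    "out (partner D (N1 \<union> N2) x) \<in> component (N1 \<union> N2) (out x)"
  using theI'[OF partner_ex1[OF assms]] unfolding partner_def by blast+

lemma partner_unique:
  assumes "overlay D N1 N2" "x \<in> D" "y \<in> D" "y \<noteq> x" "out y \<in> component (N1 \<union> N2) (out x)"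
  shows "partner D (N1 \<union> N2) x = y"
  using partner_ex1[OF assms(1,2)] partner[OF assms(1,2)] assms(3-5) by blast

lemma partner_partner:
  assumes o: "overlay D N1 N2" and x: "x \<in> D"
  shows "partner D (N1 \<union> N2) (partner D (N1 \<union> N2) x) = x"
proof -
  have "out x \<in> component (N1 \<union> N2) (out (partner D (N1 \<union> N2) x))"
    using component_eq[OF partner(3)[OF o x]] by simp
  then show ?thesis using partner_unique[OF o _ x] partner[OF o x] by metis
qed

lemma path_component_of_component:
  assumes N: "N \<subseteq> edges H" and v: "v \<in> component N u"
  shows "path_component (p ` component N u \<union> (\<Union>e\<in>{e \<in> N. e \<subseteq> component N u}. path_image (c e))) (p u) (p v)"
    (is "path_component ?A _ _")
proof -
  have "(u, v) \<in> {(x, y). \<exists>e\<in>N. x \<in> e \<and> y \<in> e}\<^sup>*" using v by (simp add: component_def)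
  then show ?thesis
  proof (induction rule: rtrancl_induct)
    case base
    show ?case by (simp add: path_component_refl)
  next
    case (step y z)
    from step(1) have y: "y \<in> component N u" by (simp add: component_def)
    from step(2) obtain e where e: "e \<in> N" "y \<in> e" "z \<in> e" by blast
    then have eK: "e \<subseteq> component N u" by (intro edge_in_component[OF _ _ y])
    have "arc (c e)" "{pathstart (c e), pathfinish (c e)} = p ` e"
      using drawing subsetD[OF N e(1)] by (simp_all add: plane_drawing_def)
    moreover from this(2) have "p y \<in> {pathstart (c e), pathfinish (c e)}" "p z \<in> {pathstart (c e), pathfinish (c e)}"
      using e by simp_all
    moreover have "{pathstart (c e), pathfinish (c e)} \<subseteq> path_image (c e)"
      using pathstart_in_path_image[of "c e"] pathfinish_in_path_image[of "c e"] by blast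
    ultimately have "p y \<in> path_image (c e)" "p z \<in> path_image (c e)" "path (c e)"
      using arc_imp_path by blast+
    then have "path_component (path_image (c e)) (p y) (p z)"
      using path_connected_path_image path_connected_component by blast
    then have "path_component ?A (p y) (p z)"
      by (rule path_component_of_subset[rotated]) (use e eK in blast)
    with step.IH show ?case by (rule path_component_trans)
  qed
qed

text \<open>Different components have disjoint drawings, since distinct edges meet only in nodes and
  a curve passes through no node except its ends. So \<open>linked_outputs_do_not_cross\<close>
  applies to them.\<close>

lemma components_do_not_cross:
  assumes o: "overlay D N1 N2" and D: "i \<in> D" "a \<in> D" "j \<in> D" "b \<in> D" and ord: "i < a" "a < j" "j < b"
    and ij: "out j \<in> component (N1 \<union> N2) (out i)" and ab: "out b \<in> component (N1 \<union> N2) (out a)"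
  shows False
proof -
  let ?N = "N1 \<union> N2"
  define Ki Ka where "Ki = component ?N (out i)" and "Ka = component ?N (out a)"
  have DL: "D \<subseteq> labels" and N: "?N \<subseteq> edges H" using o by (auto simp: overlay_def)
  \<comment> \<open>Otherwise both \<open>a\<close> and \<open>j\<close> would be the partner of
    \<open>i\<close>.\<close>
  have "out a \<notin> Ki"
  proof
    assume "out a \<in> Ki"
    then have "partner D ?N i = a" using partner_unique[OF o] D ord unfolding Ki_def by blast
    moreover have "partner D ?N i = j" using partner_unique[OF o] D ord ij by (metis less_trans less_irrefl)
    ultimately show False using ord by simp
  qed
  then have disj: "Ki \<inter> Ka = {}"
    using component_disjoint[of ?N "out i" "out a"] component_refl[of "out a" ?N] unfolding Ki_def Ka_def by blast
  have "\<Union>?N \<subseteq> nodes H" using N edge_nodes by blast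
  then have K: "Ki \<subseteq> nodes H" "Ka \<subseteq> nodes H"
    using component_subset[of ?N] out_nodes D DL unfolding Ki_def Ka_def by blast+
  let ?A = "\<lambda>K. p ` K \<union> (\<Union>e\<in>{e \<in> ?N. e \<subseteq> K}. path_image (c e))"
  have sub: "?A K \<subseteq> drawing_set H p c" if "K \<subseteq> nodes H" for K
    using that N unfolding drawing_set_def by blast
  have inj: "inj_on p (nodes H)"
    and edge_im: "\<And>e. e \<in> edges H \<Longrightarrow> path_image (c e) \<inter> p ` nodes H = p ` e"
    and cross: "\<And>e e'. e \<in> edges H \<Longrightarrow> e' \<in> edges H \<Longrightarrow> e \<noteq> e' \<Longrightarrow> path_image (c e) \<inter> path_image (c e') \<subseteq> p ` nodes H"
    using drawing unfolding plane_drawing_def by blast+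
  have node_in: "x \<in> p ` K" if "x \<in> ?A K" "x \<in> p ` nodes H" for x K
    using that edge_im N by blast
  have "?A Ki \<inter> ?A Ka = {}"
  proof (rule ccontr)
    assume "?A Ki \<inter> ?A Ka \<noteq> {}"
    then obtain x where x: "x \<in> ?A Ki" "x \<in> ?A Ka" by blast
    show False
    proof (cases "x \<in> p ` nodes H")
      case True
      then have "x \<in> p ` Ki" "x \<in> p ` Ka" using node_in[OF x(1)] node_in[OF x(2)] by blast+
      then show False using inj_on_image_Int[OF inj K] disj by blast
    next
      case False
      then obtain e e' where e: "e \<in> ?N" "e \<subseteq> Ki" "x \<in> path_image (c e)" "e' \<in> ?N" "e' \<subseteq> Ka" "x \<in> path_image (c e')"
        using x K by blast
      have "e \<noteq> {}" using edge_card[of e] e(1) N by auto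
      then have "e \<noteq> e'" using e disj by blast
      then show False using cross[of e e'] e N False by blast
    qed
  qed
  moreover have "path_component (?A Ki) (p (out i)) (p (out j))" "path_component (?A Ka) (p (out a)) (p (out b))"
    using path_component_of_component[OF N] ij ab unfolding Ki_def Ka_def by blast+
  moreover have "b < length (outputs H)" using D DL by (auto simp: labels_def)
  ultimately show False
    using linked_outputs_do_not_cross[OF ccw ord _ sub[OF K(1)] sub[OF K(2)]] by (simp add: out_def)
qed

text \<open>A pair with one end strictly between a label and its partner and the other end outside
  would cross. So the labels of \<open>D\<close> in between are paired among themselves, their
  number is even, and the two positions differ by an odd number. This is how planarity controls the
  signs.\<close>

lemma partner_rank:
  assumes o: "overlay D N1 N2" and x: "x \<in> D"
  shows "odd (rank_in D x + rank_in D (partner D (N1 \<union> N2) x))"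
proof -
  let ?\<pi> = "partner D (N1 \<union> N2)"
  have finD: "finite D" using o finite_labels finite_subset unfolding overlay_def by blast
  have main: "odd (rank_in D i + rank_in D (?\<pi> i))" if i: "i \<in> D" "i < ?\<pi> i" for i
  proof -
    let ?j = "?\<pi> i" and ?B = "{a \<in> D. i < a \<and> a < ?\<pi> i}"
    have "{a \<in> D. a < ?j} = {a \<in> D. a < i} \<union> ({i} \<union> ?B)" using i by auto
    then have "rank_in D ?j = card ({a \<in> D. a < i} \<union> ({i} \<union> ?B))" by (simp only: rank_in_def)
    also have "\<dots> = card {a \<in> D. a < i} + card ({i} \<union> ?B)" using finD by (intro card_Un_disjoint) auto
    also have "card ({i} \<union> ?B) = 1 + card ?B" using finD by (subst card_Un_disjoint) auto
    finally have "rank_in D ?j = rank_in D i + 1 + card ?B" by (simp add: rank_in_def)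
    moreover have "even (card ?B)"
    proof (rule even_card_involution[of _ ?\<pi>])
      show "finite ?B" using finD by simp
      fix a assume a: "a \<in> ?B"
      let ?b = "?\<pi> a"
      have b: "?b \<in> D" "?b \<noteq> a" "?\<pi> ?b = a" using partner[OF o] partner_partner[OF o] a by auto
      have comp: "out ?j \<in> component (N1 \<union> N2) (out i)" "out ?b \<in> component (N1 \<union> N2) (out a)"
        using partner(3)[OF o] i a by auto
      have comp': "out a \<in> component (N1 \<union> N2) (out ?b)" using component_eq[OF comp(2)] by simp
      have jj: "?\<pi> ?j = i" "?j \<in> D" using partner_partner[OF o i(1)] partner(1)[OF o i(1)] by auto
      have "?b \<noteq> i" "?b \<noteq> ?j" using b a jj by auto
      moreover have "\<not> ?j < ?b"
        using components_do_not_cross[OF o i(1) _ jj(2) b(1) _ _ _ comp] a by auto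
      moreover have "\<not> ?b < i"
        using components_do_not_cross[OF o b(1) i(1) _ jj(2) _ _ _ comp' comp(1)] a by auto
      ultimately show "?b \<in> ?B \<and> ?b \<noteq> a \<and> ?\<pi> ?b = a" using b by auto
    qed
    ultimately show ?thesis by simp
  qed
  show ?thesis
  proof (cases "x < ?\<pi> x")
    case False
    then have "?\<pi> x < x" using partner(2)[OF o x] by simp
    then show ?thesis
      using main[of "?\<pi> x"] partner(1)[OF o x] partner_partner[OF o x] by (simp add: add.commute)
  qed (use main x in blast)
qed

end

context drawn_gate
begin

text \<open>
  Exchanging the two matchings on the component of \<open>out i\<close> moves a summand with index \<open>i\<close> to one whose
  index is the other end of that component, with the same weight and the opposite sign.
\<close>

theorem sig_matchgate_identities: "matchgate_identities labels sig"
  unfolding matchgate_identities_def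
proof (intro allI impI)
  fix X Y assume X: "X \<subseteq> labels" and Y: "Y \<subseteq> labels"
  define D where "D = sym_diff X Y"
  have DL: "D \<subseteq> labels" using X Y by (auto simp: D_def)
  have finD: "finite D" using DL finite_labels finite_subset by blast
  define T where "T = (SIGMA i:D. matchings (sym_diff X {i}) \<times> matchings (sym_diff Y {i}))"
  define g :: "nat \<times> 'v set set \<times> 'v set set \<Rightarrow> complex" where
    "g = (\<lambda>(i, N1, N2). (-1) ^ rank_in D i * (prod (weight H) N1 * prod (weight H) N2))"
  define \<psi> where "\<psi> = (\<lambda>(i, N1, N2). let K = component (N1 \<union> N2) (out i) in
    (partner D (N1 \<union> N2) i, swap_on K N1 N2, swap_on K N2 N1))"
  \<comment> \<open>Stated for arbitrary \<open>X'\<close> and \<open>Y'\<close>, so that the second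
    matching is covered by exchanging their roles.\<close>
  have swap_matching: "swap_on (component (N1 \<union> N2) (out i)) N1 N2 \<in> matchings (sym_diff X' {partner D (N1 \<union> N2) i})"
    if o: "overlay D N1 N2" and i: "i \<in> D" and X': "X' \<subseteq> labels" "Y' \<subseteq> labels" "D = sym_diff X' Y'"
      and N: "N1 \<in> matchings (sym_diff X' {i})" "N2 \<in> matchings (sym_diff Y' {i})" for X' Y' i N1 N2
  proof -
    let ?K = "component (N1 \<union> N2) (out i)" and ?j = "partner D (N1 \<union> N2) i"
    have j: "?j \<in> D" "?j \<noteq> i" "out ?j \<in> ?K" using partner[OF o i] by auto
    have s: "sym_diff X' {i} \<subseteq> labels" "sym_diff Y' {i} \<subseteq> labels" "sym_diff X' {?j} \<subseteq> labels"
      using X' i j DL by blast+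
    note m = N(1)[unfolded in_matchings_iff[OF s(1)]] N(2)[unfolded in_matchings_iff[OF s(2)]]
    have dK: "edge_degree (swap_on ?K N1 N2) v = (if v \<in> ?K then edge_degree N2 v else edge_degree N1 v)" for v
      using edge_in_component[of _ "N1 \<union> N2" _ "out i"] by (intro edge_degree_swap_on) blast
    have "edge_degree (swap_on ?K N1 N2) v = of_bool (v \<notin> out ` sym_diff X' {?j})" if v: "v \<in> nodes H" for v
    proof -
      have d: "edge_degree N1 v = of_bool (v \<notin> out ` sym_diff X' {i})" "edge_degree N2 v = of_bool (v \<notin> out ` sym_diff Y' {i})"
        using m v by blast+
      show ?thesis
      proof (cases "v \<in> out ` labels")
        case True
        then obtain x where x: "x \<in> labels" "v = out x" by blast
        have inD: "x \<in> D \<longleftrightarrow> (x \<in> X') \<noteq> (x \<in> Y')" "i \<in> X' \<longleftrightarrow> i \<notin> Y'" "?j \<in> X' \<longleftrightarrow> ?j \<notin> Y'"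
          using X'(3) i j by blast+
        \<comment> \<open>Within \<open>D\<close> the component contains only \<open>i\<close> and
          \<open>?j\<close>, and there the exchange moves the flip from \<open>i\<close> to
          \<open>?j\<close>. At its other outputs the two matchings have equal degree.\<close>
        have "out x \<in> ?K \<longleftrightarrow> x = i \<or> x = ?j" if "x \<in> D"
          using that partner_unique[OF o i that] j by auto
        then show ?thesis
          unfolding dK d unfolding x(2) out_image_iff[OF s(1) x(1)] out_image_iff[OF s(2) x(1)] out_image_iff[OF s(3) x(1)]
          using inD j(2) by (cases "x = i"; cases "x = ?j"; cases "x \<in> X'"; cases "x \<in> Y'") auto
      next
        case False
        then have "v \<notin> out ` sym_diff X' {i}" "v \<notin> out ` sym_diff Y' {i}" "v \<notin> out ` sym_diff X' {?j}" using s by blast+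
        then show ?thesis unfolding dK d by (simp only: if_cancel)
      qed
    qed
    moreover have "swap_on ?K N1 N2 \<subseteq> edges H" using m by (auto simp: swap_on_def)
    ultimately show ?thesis unfolding in_matchings_iff[OF s(3)] by blast
  qed
  have inv: "\<psi> t \<in> T \<and> \<psi> (\<psi> t) = t \<and> g (\<psi> t) = - g t" if tT: "t \<in> T" for t
  proof -
    obtain i N1 N2 where t: "t = (i, N1, N2)" by (cases t) auto
    have i: "i \<in> D" and N: "N1 \<in> matchings (sym_diff X {i})" "N2 \<in> matchings (sym_diff Y {i})"
      using tT by (auto simp: T_def t)
    have iL: "i \<in> labels" using i DL by blast
    have o: "overlay D N1 N2" using overlay_matchings[OF X Y iL N] by (simp add: D_def)
    have o': "overlay D N2 N1" using o by (simp add: overlay_def add.commute)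
    let ?K = "component (N1 \<union> N2) (out i)" and ?j = "partner D (N1 \<union> N2) i"
    let ?M1 = "swap_on ?K N1 N2" and ?M2 = "swap_on ?K N2 N1"
    have \<psi>t: "\<psi> t = (?j, ?M1, ?M2)" by (simp add: \<psi>_def t Let_def)
    have un: "?M1 \<union> ?M2 = N1 \<union> N2" by (rule swap_on_Un)
    have D': "D = sym_diff Y X" by (auto simp: D_def)
    have "?M1 \<in> matchings (sym_diff X {?j})" using swap_matching[OF o i X Y D_def N] .
    moreover have "?M2 \<in> matchings (sym_diff Y {?j})"
      using swap_matching[OF o' i Y X D' N(2,1)] by (simp only: Un_commute)
    ultimately have "\<psi> t \<in> T" unfolding \<psi>t T_def using partner(1)[OF o i] by blast
    moreover have "component (N1 \<union> N2) (out ?j) = ?K" by (rule component_eq[OF partner(3)[OF o i]])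
    then have "\<psi> (\<psi> t) = t"
      unfolding \<psi>t by (simp add: \<psi>_def Let_def un partner_partner[OF o i] swap_on_swap_on t)
    moreover have "g (\<psi> t) = - g t"
    proof -
      have "N1 \<subseteq> edges H" "N2 \<subseteq> edges H" using o by (auto simp: overlay_def)
      then have "finite N1" "finite N2" using finite_edges finite_subset by blast+
      then have "prod (weight H) ?M1 * prod (weight H) ?M2 = prod (weight H) N1 * prod (weight H) N2"
        by (rule prod_swap_on)
      moreover have "(-1) ^ rank_in D ?j = - ((-1) ^ rank_in D i :: complex)"
        using partner_rank[OF o i] by (cases "even (rank_in D i)") auto
      ultimately show ?thesis unfolding t \<psi>t[unfolded t] g_def by simp
    qed
    ultimately show ?thesis by blast
  qed
  have "(\<Sum>t\<in>T. g t) = (\<Sum>t\<in>T. - g t)"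
    by (rule sum.reindex_bij_witness[of _ \<psi> \<psi>]) (use inv in auto)
  then have "(\<Sum>t\<in>T. g t) = 0" by (simp add: sum_negf)
  moreover have "(\<Sum>t\<in>T. g t) = (\<Sum>i\<in>D. (-1) ^ rank_in D i * (sig (sym_diff X {i}) * sig (sym_diff Y {i})))"
  proof -
    have "(\<Sum>t\<in>T. g t) = (\<Sum>i\<in>D. \<Sum>(N1, N2)\<in>matchings (sym_diff X {i}) \<times> matchings (sym_diff Y {i}).
        (-1) ^ rank_in D i * (prod (weight H) N1 * prod (weight H) N2))"
      unfolding T_def g_def using finD finite_matchings by (subst sum.Sigma[symmetric]) auto
    also have "\<dots> = (\<Sum>i\<in>D. (-1) ^ rank_in D i * (sig (sym_diff X {i}) * sig (sym_diff Y {i})))"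
      unfolding sig_eq sum_product unfolding sum_distrib_left sum.cartesian_product by (simp add: case_prod_unfold)
    finally show ?thesis .
  qed
  ultimately show "(\<Sum>i\<in>sym_diff X Y. (-1) ^ rank_in (sym_diff X Y) i *
      (sig (sym_diff X {i}) * sig (sym_diff Y {i}))) = 0"
    unfolding D_def by simp
qed

end

section \<open>Tensors and words\<close>

definition words :: "nat \<Rightarrow> nat \<Rightarrow> nat list set" where
  "words b n = {w. length w = n \<and> set w \<subseteq> {..<b}}"

lemma word_index_snoc: "word_index b (w @ [a]) = a + b * word_index b w"
  by (simp add: word_index_def)

text \<open>The digits of the high part come first, so cutting a word into blocks is division with
  remainder by \<open>b ^ l\<close>.\<close>

lemma index_word_add:
  assumes "a < b ^ l"
  shows "index_word b (m + l) (a + b ^ l * x) = index_word b m x @ index_word b l a"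
proof -
  have b: "b > 0 \<or> l = 0" using assms by (cases "b = 0"; cases l) simp_all
  have bl: "b ^ l \<noteq> 0" using assms by (metis not_less_zero)
  have up: "[0..<m + l] = [0..<m] @ map (\<lambda>i. i + m) [0..<l]"
    using upt_add_eq_append[of 0 m l] by (simp add: map_add_upt add.commute)
  have "(a + b ^ l * x) div b ^ (m + l - 1 - s) mod b = x div b ^ (m - 1 - s) mod b" if "s < m" for s
  proof -
    have "m + l - 1 - s = l + (m - 1 - s)" using that by simp
    then have "(a + b ^ l * x) div b ^ (m + l - 1 - s) = (a + b ^ l * x) div b ^ l div b ^ (m - 1 - s)"
      by (simp add: power_add div_mult2_eq)
    also have "(a + b ^ l * x) div b ^ l = x" using assms bl by simp
    finally show ?thesis by simp
  qed
  moreover have "(a + b ^ l * x) div b ^ (m + l - 1 - (i + m)) mod b = a div b ^ (l - 1 - i) mod b" if "i < l" for i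
  proof -
    have b0: "b > 0" using b that by auto
    have "b ^ l = b ^ (l - 1 - i) * (b * b ^ i)" using that power_add[of b "l - 1 - i" "Suc i"] by simp
    then have "(a + b ^ l * x) div b ^ (l - 1 - i) = (a + b ^ (l - 1 - i) * (b * (b ^ i * x))) div b ^ (l - 1 - i)"
      by (simp add: mult.assoc)
    also have "\<dots> = b * (b ^ i * x) + a div b ^ (l - 1 - i)" using b0 by simp
    finally show ?thesis by (simp add: diff_diff_eq add.commute)
  qed
  ultimately show ?thesis unfolding index_word_def up by simp
qed

lemma index_word_Suc: "b > 0 \<Longrightarrow> a < b \<Longrightarrow> index_word b (Suc n) (a + b * x) = index_word b n x @ [a]"
  using index_word_add[of a b 1 n x] by (simp add: index_word_def)

lemma length_index_word [simp]: "length (index_word b n x) = n"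
  by (simp add: index_word_def)

lemma index_word_in_words: "b > 0 \<Longrightarrow> index_word b n x \<in> words b n"
  by (auto simp: words_def index_word_def)

lemma word_index_of_word:
  assumes "b > 0" "w \<in> words b n"
  shows "word_index b w < b ^ n \<and> index_word b n (word_index b w) = w"
  using assms(2)
proof (induction w arbitrary: n rule: rev_induct)
  case Nil
  then show ?case by (simp add: words_def word_index_def index_word_def)
next
  case (snoc a w)
  then obtain m where n: "n = Suc m" and w: "w \<in> words b m" and a: "a < b" by (auto simp: words_def)
  have lt: "word_index b w < b ^ m" and eq: "index_word b m (word_index b w) = w" using snoc.IH[OF w] by auto
  have "a + b * word_index b w < b + b * word_index b w" using a by simp
  also have "\<dots> = b * Suc (word_index b w)" by simp
  also have "\<dots> \<le> b * b ^ m" using lt by (intro mult_le_mono2) simp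
  finally show ?case using eq a assms(1) by (simp add: n word_index_snoc index_word_Suc)
qed

lemma word_index_index_word: "b > 0 \<Longrightarrow> x < b ^ n \<Longrightarrow> word_index b (index_word b n x) = x"
proof (induction n arbitrary: x)
  case 0
  then show ?case by (simp add: word_index_def index_word_def)
next
  case (Suc n)
  have "index_word b (Suc n) x = index_word b n (x div b) @ [x mod b]"
    using index_word_Suc[OF Suc.prems(1), of "x mod b" n "x div b"] Suc.prems(1) by simp
  moreover have "x div b < b ^ n" using Suc.prems by (simp add: less_mult_imp_div_less mult.commute)
  ultimately show ?case using Suc.IH[OF Suc.prems(1)] by (simp add: word_index_snoc)
qed

lemma sum_words:
  assumes "b > 0"
  shows "(\<Sum>x<b ^ n. f (index_word b n x)) = (\<Sum>w\<in>words b n. f w)"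
  by (rule sum.reindex_bij_witness[of _ "word_index b" "index_word b n"])
    (use assms word_index_of_word word_index_index_word index_word_in_words in auto)

text \<open>This justifies reading one vector both as a tensor over \<open>b ^ l\<close> and as a
  tensor over \<open>b\<close>: the lexicographic orders agree.\<close>

lemma index_word_blocks:
  assumes "b > 0" "W \<in> words (b ^ l) n"
  shows "index_word b (n * l) (word_index (b ^ l) W) = concat (map (index_word b l) W)"
  using assms(2)
proof (induction W arbitrary: n rule: rev_induct)
  case Nil
  then show ?case by (simp add: words_def index_word_def)
next
  case (snoc a W)
  then obtain m where n: "n = Suc m" and W: "W \<in> words (b ^ l) m" and a: "a < b ^ l" by (auto simp: words_def)
  have "index_word b (m * l + l) (a + b ^ l * word_index (b ^ l) W) = index_word b (m * l) (word_index (b ^ l) W) @ index_word b l a"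
    by (rule index_word_add[OF a])
  then show ?case using snoc.IH[OF W] by (simp add: n word_index_snoc add.commute)
qed

text \<open>Places count from 0, so the argument \<open>t\<close> of \<open>flattening\<close>
  corresponds to \<open>i = t - 1\<close>.\<close>

definition insert_at :: "nat \<Rightarrow> 'a \<Rightarrow> 'a list \<Rightarrow> 'a list" where
  "insert_at i a w = take i w @ [a] @ drop i w"

lemma insert_at_in_words:
  assumes "i < n" "a < b" "w \<in> words b (n - 1)"
  shows "insert_at i a w \<in> words b n"
  using assms set_take_subset[of i w] set_drop_subset[of i w] by (auto simp: words_def insert_at_def)

lemma sum_insert_at:
  assumes "i < n"
  shows "(\<Sum>W\<in>words b n. f W) = (\<Sum>j<b. \<Sum>w\<in>words b (n - 1). f (insert_at i j w))"
proof -
  let ?h = "\<lambda>(j, w). insert_at i j w"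
  have "(\<Sum>W\<in>words b n. f W) = (\<Sum>jw\<in>{..<b} \<times> words b (n - 1). f (?h jw))"
  proof (rule sum.reindex_bij_witness[of _ ?h "\<lambda>W. (W ! i, take i W @ drop (Suc i) W)"])
    fix W assume W: "W \<in> words b n"
    then have "W = take i W @ W ! i # drop (Suc i) W" using assms by (simp add: words_def id_take_nth_drop)
    then show "?h (W ! i, take i W @ drop (Suc i) W) = W"
      using assms W by (simp add: insert_at_def words_def min_def)
    show "(W ! i, take i W @ drop (Suc i) W) \<in> {..<b} \<times> words b (n - 1)"
    proof -
      have "W ! i \<in> set W" "set W \<subseteq> {..<b}" using assms W by (simp_all add: words_def)
      then have "W ! i < b" by blast
      then show ?thesis using assms W set_take_subset[of i W] set_drop_subset[of "Suc i" W]
        by (auto simp: words_def)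
    qed
    show "f (?h (W ! i, take i W @ drop (Suc i) W)) = f W"
      using \<open>?h (W ! i, take i W @ drop (Suc i) W) = W\<close> by simp
  next
    fix jw assume "jw \<in> {..<b} \<times> words b (n - 1)"
    then obtain j w where jw: "jw = (j, w)" "j < b" "w \<in> words b (n - 1)" by auto
    then have "length w = n - 1" by (simp add: words_def)
    then have "length (take i w) = i" using assms by simp
    then show "(?h jw ! i, take i (?h jw) @ drop (Suc i) (?h jw)) = jw"
      by (simp add: jw insert_at_def nth_append)
    show "?h jw \<in> words b n" using insert_at_in_words[OF assms jw(2,3)] by (simp add: jw)
  qed
  then show ?thesis by (simp add: sum.cartesian_product case_prod_unfold)
qed

text \<open>The entry of \<open>tensor_power\<close> at two words, written as a product of a list so
  that single factors can be split off.\<close>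

definition kernel_product :: "complex Matrix.mat \<Rightarrow> nat list \<Rightarrow> nat list \<Rightarrow> complex" where
  "kernel_product M x y = prod_list (map2 (\<lambda>a b. M $$ (a, b)) x y)"

lemma kernel_product_eq:
  "length x = n \<Longrightarrow> length y = n \<Longrightarrow> kernel_product M x y = (\<Prod>s<n. M $$ (x ! s, y ! s))"
proof (induction n arbitrary: x y)
  case (Suc n)
  then obtain a x' b y' where xy: "x = a # x'" "y = b # y'" "length x' = n" "length y' = n"
    by (metis length_Suc_conv)
  have "kernel_product M x y = M $$ (a, b) * kernel_product M x' y'" by (simp add: kernel_product_def xy)
  also have "\<dots> = M $$ (a, b) * (\<Prod>s<n. M $$ (x' ! s, y' ! s))" using Suc.IH xy by simp
  also have "\<dots> = (\<Prod>s<Suc n. M $$ (x ! s, y ! s))" by (simp add: xy prod.lessThan_Suc_shift del: prod.lessThan_Suc)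
  finally show ?case .
qed (simp add: kernel_product_def)

lemma kernel_product_insert_at:
  assumes "length x = length y"
  shows "kernel_product M (insert_at i a x) (insert_at i j y) = M $$ (a, j) * kernel_product M x y"
proof -
  have "kernel_product M x y = kernel_product M (take i x @ drop i x) (take i y @ drop i y)" by simp
  then show ?thesis
    unfolding kernel_product_def insert_at_def using assms
    by (simp add: zip_append del: append_take_drop_id)
qed

lemma tensor_power_mult_index:
  assumes M: "M \<in> carrier_mat r k" "r > 0" "k > 0" and G: "G \<in> carrier_vec (k ^ n)" and x: "x \<in> words r n"
  shows "(tensor_power n M *\<^sub>v G) $ word_index r x = (\<Sum>y\<in>words k n. kernel_product M x y * G $ word_index k y)"
proof -
  let ?X = "word_index r x"
  have X: "?X < r ^ n" "index_word r n ?X = x" using word_index_of_word[OF M(2) x] by auto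
  have lx: "length x = n" using x by (simp add: words_def)
  have "(tensor_power n M *\<^sub>v G) $ ?X = (\<Sum>y<k ^ n. (\<Prod>s<n. M $$ (x ! s, index_word k n y ! s)) * G $ y)"
    using M G X by (simp add: tensor_power_def scalar_prod_def lessThan_atLeast0)
  also have "\<dots> = (\<Sum>y<k ^ n. kernel_product M x (index_word k n y) * G $ word_index k (index_word k n y))"
    using M(3) lx by (intro sum.cong refl) (simp add: kernel_product_eq word_index_index_word)
  also have "\<dots> = (\<Sum>y\<in>words k n. kernel_product M x y * G $ word_index k y)"
    by (rule sum_words[OF M(3)])
  finally show ?thesis .
qed

text \<open>A tensor power of an injective map is injective: injectivity of \<open>M\<close> handles
  the first letter while the others stay contracted, and induction handles these.\<close>

lemma kernel_product_injective:
  assumes inj: "\<And>h. (\<And>a. a < r \<Longrightarrow> (\<Sum>j<k. M $$ (a, j) * h j) = 0) \<Longrightarrow> (\<And>j. j < k \<Longrightarrow> h j = 0)"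
    and "\<And>x. x \<in> words r m \<Longrightarrow> (\<Sum>y\<in>words k m. kernel_product M x y * g y) = 0"
    and "y \<in> words k m"
  shows "g y = 0"
  using assms(2,3)
proof (induction m arbitrary: g y)
  case 0
  have "words b 0 = {[]}" for b by (auto simp: words_def)
  then show ?case using 0 by (simp add: kernel_product_def)
next
  case (Suc m)
  have w0: "a # x \<in> words b (Suc m)" if "a < b" "x \<in> words b m" for a x b
    using that by (auto simp: words_def)
  have zero: "(\<Sum>y\<in>words k m. kernel_product M x y * g (j # y)) = 0" if x: "x \<in> words r m" and j: "j < k" for x j
  proof (rule inj[of "\<lambda>j. \<Sum>y\<in>words k m. kernel_product M x y * g (j # y)", OF _ j])
    fix a assume "a < r"
    then have "0 = (\<Sum>y\<in>words k (Suc m). kernel_product M (a # x) y * g y)" using Suc.prems(1)[OF w0[OF _ x]] by simp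
    also have "\<dots> = (\<Sum>j<k. \<Sum>y\<in>words k m. kernel_product M (a # x) (j # y) * g (j # y))"
      by (subst sum_insert_at[of 0]) (simp_all add: insert_at_def)
    finally show "(\<Sum>j<k. M $$ (a, j) * (\<Sum>y\<in>words k m. kernel_product M x y * g (j # y))) = 0"
      by (simp add: kernel_product_def sum_distrib_left mult.assoc)
  qed
  obtain j y' where y: "y = j # y'" "j < k" "y' \<in> words k m"
    using Suc.prems(2) by (cases y) (auto simp: words_def)
  show ?case using Suc.IH[of "\<lambda>y. g (j # y)", OF zero y(3)] y by simp
qed

section \<open>Injectivity from full rank, and small linear systems\<close>

lemma (in vec_space) rank_independent_columns:
  assumes "A \<in> carrier_mat n nc"
  obtains S where "S \<subseteq> set (cols A)" "lin_indpt S" "card S = rank A"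
proof -
  obtain S where S: "maximal S (\<lambda>T. T \<subseteq> set (cols A) \<and> lin_indpt T)"
    using maximal_exists[of "(\<lambda>T. T \<subseteq> set (cols A) \<and> lin_indpt T)" "card (set (cols A))" "{}"]
    by (meson List.finite_set card_mono empty_iff empty_subsetI finite_lin_indpt2 rev_finite_subset)
  then have "S \<subseteq> set (cols A)" "lin_indpt S" by (simp_all add: maximal_def)
  then show thesis using rank_card_indpt[OF assms S] by (intro that[of S]) simp_all
qed

lemma full_column_rank_injective:
  fixes M :: "complex Matrix.mat"
  assumes M: "M \<in> carrier_mat r k" and rk: "vec_space.rank r M = k"
    and zero: "\<And>a. a < r \<Longrightarrow> (\<Sum>j<k. M $$ (a, j) * h j) = 0" and "j < k"
  shows "h j = 0"
proof (rule ccontr)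
  assume "h j \<noteq> 0"
  interpret vec_space "TYPE(complex)" r .
  let ?v = "Matrix.vec k h"
  \<comment> \<open>Linear independence is a property of the set of columns and does not see
    repetitions, so distinctness is needed separately.\<close>
  have d: "distinct (cols M)"
  proof -
    obtain S where S: "S \<subseteq> set (cols M)" "card S = k" using rank_independent_columns[OF M] rk by metis
    then have "k \<le> card (set (cols M))" by (metis List.finite_set card_mono)
    then show ?thesis using M card_length[of "cols M"] by (intro card_distinct) simp
  qed
  have "?v \<noteq> 0\<^sub>v k" using \<open>h j \<noteq> 0\<close> \<open>j < k\<close> by (metis index_vec index_zero_vec(1))
  moreover have "M *\<^sub>v ?v = 0\<^sub>v r"
    using M zero by (intro eq_vecI) (auto simp: scalar_prod_def lessThan_atLeast0)
  ultimately have "lin_dep (set (cols M))" by (intro lin_depI[OF M _ _ _ d, of ?v]) simp_all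
  then show False using full_rank_lin_indpt[OF M rk d] by blast
qed

text \<open>Some \<open>k\<close> independent columns of \<open>F\<close> form an invertible square
  matrix \<open>B\<close>, and the vector \<open>x\<close> lies in the kernel of its
  transpose.\<close>

lemma full_row_rank_injective:
  fixes F :: "complex Matrix.mat"
  assumes F: "F \<in> carrier_mat k nc" and rk: "vec_space.rank k F = k"
    and zero: "\<And>c. c < nc \<Longrightarrow> (\<Sum>j<k. x j * F $$ (j, c)) = 0" and j: "j < k"
  shows "x j = 0"
proof (rule ccontr)
  assume "x j \<noteq> 0"
  interpret vec_space "TYPE(complex)" k .
  obtain S where S': "S \<subseteq> set (cols F)" "lin_indpt S" and cS: "card S = k"
    using rank_independent_columns[OF F] rk by metis
  have "finite S" using S'(1) finite_subset by blast
  then obtain vs where vs: "distinct vs" "set vs = S" using finite_distinct_list by blast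
  have lvs: "length vs = k" using vs cS distinct_card by fastforce
  have vc: "set vs \<subseteq> carrier_vec k" using vs S' cols_dim[of F] F by auto
  define B where "B = mat_of_cols k vs"
  have B: "B \<in> carrier_mat k k" using mat_of_cols_carrier(1)[of k vs] lvs by (simp add: B_def)
  have cB: "cols B = vs" unfolding B_def using vc by (rule cols_mat_of_cols)
  have "rank B = k" using lin_indpt_full_rank[OF B] cB vs S' by simp
  then have "det B \<noteq> 0" using det_rank_iff[OF B] by simp
  then have "det (transpose_mat B) \<noteq> 0" using det_transpose[OF B] by simp
  let ?v = "Matrix.vec k x"
  have "transpose_mat B *\<^sub>v ?v = 0\<^sub>v k"
  proof (rule eq_vecI)
    fix i assume "i < dim_vec (0\<^sub>v k :: complex Matrix.vec)"
    then have i: "i < k" by simp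
    have "vs ! i \<in> set (cols F)" using i lvs vs S' nth_mem by blast
    then obtain c where c: "c < nc" "vs ! i = col F c" using F by (auto simp: cols_def)
    have "row (transpose_mat B) i = vs ! i" using i B cB lvs by (metis carrier_matD(2) cols_nth row_transpose)
    then have "(transpose_mat B *\<^sub>v ?v) $ i = col F c \<bullet> ?v" using i B c by simp
    also have "\<dots> = (\<Sum>j<k. x j * F $$ (j, c))"
      using F c by (simp add: scalar_prod_def lessThan_atLeast0 mult.commute)
    finally show "(transpose_mat B *\<^sub>v ?v) $ i = 0\<^sub>v k $ i" using zero[OF c(1)] i by simp
  qed (use B in auto)
  moreover have "?v \<noteq> 0\<^sub>v k" using \<open>x j \<noteq> 0\<close> j by (metis index_vec index_zero_vec(1))
  ultimately show False
    using \<open>det (transpose_mat B) \<noteq> 0\<close> det_0_iff_vec_prod_zero_field[of "transpose_mat B" k] B vec_carrier[of k x]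
    by (metis transpose_carrier_mat)
qed

text \<open>The equations are padded with zero rows to a square matrix. Row 2 exists because
  \<open>k \<ge> 3\<close> and is zero, so the matrix is singular.\<close>

lemma two_equations_nontrivial_solution:
  fixes a b :: "nat \<Rightarrow> complex"
  assumes "k \<ge> 3"
  obtains x j where "j < k" "x j \<noteq> 0" "(\<Sum>j<k. x j * a j) = 0" "(\<Sum>j<k. x j * b j) = 0"
proof -
  define A where "A = Matrix.mat k k (\<lambda>(i, j). if i = 0 then a j else if i = 1 then b j else 0)"
  have A: "A \<in> carrier_mat k k" by (simp add: A_def)
  have "transpose_mat A *\<^sub>v unit_vec k 2 = 0\<^sub>v k" using assms by (intro eq_vecI) (auto simp: A_def)
  moreover have "unit_vec k 2 \<noteq> (0\<^sub>v k :: complex Matrix.vec)"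
    using assms by (metis index_unit_vec(1) index_zero_vec(1) less_le_trans numeral_less_iff semiring_norm(77) zero_neq_one lessI numeral_3_eq_3 numeral_2_eq_2)
  ultimately have "det (transpose_mat A) = 0"
    using det_0_iff_vec_prod_zero_field[of "transpose_mat A" k] A
    by (metis transpose_carrier_mat unit_vec_carrier)
  then have "det A = 0" using det_transpose[OF A] by simp
  then obtain v where v: "v \<in> carrier_vec k" "v \<noteq> 0\<^sub>v k" "A *\<^sub>v v = 0\<^sub>v k"
    using det_0_iff_vec_prod_zero_field[OF A] by blast
  have "(A *\<^sub>v v) $ i = (\<Sum>j<k. v $ j * A $$ (i, j))" if "i < k" for i
    using that A v(1) by (simp add: scalar_prod_def lessThan_atLeast0 mult.commute)
  then have "(\<Sum>j<k. v $ j * A $$ (i, j)) = 0" if "i < k" for i using that v(3) by simp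
  from this[of 0] this[of 1] have "(\<Sum>j<k. v $ j * a j) = 0" "(\<Sum>j<k. v $ j * b j) = 0"
    using assms by (simp_all add: A_def)
  moreover obtain j where "j < k" "v $ j \<noteq> 0"
    using v(1,2) by (metis carrier_vecD eq_vecI index_zero_vec)
  ultimately show thesis using that[of j "\<lambda>j. v $ j"] by blast
qed

text \<open>The pairs \<open>(v1 w, v2 w)\<close> lie in a plane. If two of them are independent,
  Cramer's rule expresses the rest; otherwise one nonzero pair suffices, or any element when all are
  zero, and then \<open>p\<close> and \<open>q\<close> coincide.\<close>

lemma two_dimensional_generators:
  fixes v1 v2 :: "'w \<Rightarrow> complex"
  assumes "W \<noteq> {}"
  obtains p q where "p \<in> W" "q \<in> W"
    "\<And>w. w \<in> W \<Longrightarrow> \<exists>a b. v1 w = a * v1 p + b * v1 q \<and> v2 w = a * v2 p + b * v2 q"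
proof (cases "\<exists>p\<in>W. \<exists>q\<in>W. v1 p * v2 q \<noteq> v1 q * v2 p")
  case True
  then obtain p q where pq: "p \<in> W" "q \<in> W" "v1 p * v2 q - v1 q * v2 p \<noteq> 0" by auto
  show thesis
  proof (rule that[OF pq(1,2)])
    fix w
    let ?d = "v1 p * v2 q - v1 q * v2 p"
    have "v1 w = (v1 w * v2 q - v1 q * v2 w) / ?d * v1 p + (v1 p * v2 w - v1 w * v2 p) / ?d * v1 q"
      "v2 w = (v1 w * v2 q - v1 q * v2 w) / ?d * v2 p + (v1 p * v2 w - v1 w * v2 p) / ?d * v2 q"
      unfolding times_divide_eq_left add_divide_distrib[symmetric] eq_divide_eq using pq(3)
      by (simp_all add: algebra_simps)
    then show "\<exists>a b. v1 w = a * v1 p + b * v1 q \<and> v2 w = a * v2 p + b * v2 q" by blast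
  qed
next
  case False
  then have dep: "v1 p * v2 q = v1 q * v2 p" if "p \<in> W" "q \<in> W" for p q using that by blast
  show thesis
  proof (cases "\<exists>p\<in>W. v1 p \<noteq> 0 \<or> v2 p \<noteq> 0")
    case True
    then obtain p where p: "p \<in> W" "v1 p \<noteq> 0 \<or> v2 p \<noteq> 0" by blast
    show thesis
    proof (rule that[OF p(1,1)])
      fix w assume w: "w \<in> W"
      let ?a = "if v1 p \<noteq> 0 then v1 w / v1 p else v2 w / v2 p"
      have "v1 w = ?a * v1 p + 0 * v1 p \<and> v2 w = ?a * v2 p + 0 * v2 p"
        using dep[OF p(1) w] p(2) by (auto simp: field_simps)
      then show "\<exists>a b. v1 w = a * v1 p + b * v1 p \<and> v2 w = a * v2 p + b * v2 p" by blast
    qed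
  next
    case False
    obtain p where "p \<in> W" using assms by blast
    then show thesis using that[of p p] False by (metis add_0 mult_zero_left)
  qed
qed

lemma flattening_not_rank_le_2:
  fixes M :: "complex Matrix.mat" and G :: "complex Matrix.vec"
  assumes k: "k \<ge> 3" and n: "n \<ge> 1" and r: "r > 0" and G: "G \<in> carrier_vec (k ^ n)" and t: "t \<in> {1..n}"
    and rF: "vec_space.rank k (flattening k n t G) = k"
    and M: "M \<in> carrier_mat r k" "vec_space.rank r M = k"
  shows "\<not> (\<exists>u1 v1 u2 v2. \<forall>a<r. \<forall>c<r ^ (n - 1).
    flattening r n t (tensor_power n M *\<^sub>v G) $$ (a, c) = u1 a * v1 c + u2 a * v2 c)"
proof
  assume "\<exists>u1 v1 u2 v2. \<forall>a<r. \<forall>c<r ^ (n - 1).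
    flattening r n t (tensor_power n M *\<^sub>v G) $$ (a, c) = u1 a * v1 c + u2 a * v2 c"
  then obtain u1 v1 u2 v2 where uv: "\<And>a c. a < r \<Longrightarrow> c < r ^ (n - 1) \<Longrightarrow>
    flattening r n t (tensor_power n M *\<^sub>v G) $$ (a, c) = u1 a * v1 c + u2 a * v2 c" by blast
  have k0: "k > 0" using k by simp
  have t': "t - 1 < n" using t by auto
  define g where "g j y = G $ word_index k (insert_at (t - 1) j y)" for j y
  \<comment> \<open>\<open>M\<close> is applied to all arguments except the one at \<open>t\<close>.
    The remaining factor acts as an ordinary matrix on the index \<open>j\<close>, and its
    injectivity pulls linear relations between columns of the flattening back to
    \<open>h\<close>.\<close>
  define h where "h j w = (\<Sum>y\<in>words k (n - 1). kernel_product M w y * g j y)" for j w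
  define V1 V2 where "V1 w = v1 (word_index r w)" and "V2 w = v2 (word_index r w)" for w
  note injM = full_column_rank_injective[OF M]
  have dec: "(\<Sum>j<k. M $$ (a, j) * h j w) = u1 a * V1 w + u2 a * V2 w" if a: "a < r" and w: "w \<in> words r (n - 1)" for a w
  proof -
    let ?c = "word_index r w"
    have c: "?c < r ^ (n - 1)" "index_word r (n - 1) ?c = w" using word_index_of_word[OF r w] by auto
    have "u1 a * V1 w + u2 a * V2 w = flattening r n t (tensor_power n M *\<^sub>v G) $$ (a, ?c)"
      using uv[OF a c(1)] by (simp add: V1_def V2_def)
    also have "\<dots> = (tensor_power n M *\<^sub>v G) $ word_index r (insert_at (t - 1) a w)"
      using a c by (simp add: flattening_def Let_def insert_at_def)
    also have "\<dots> = (\<Sum>y\<in>words k n. kernel_product M (insert_at (t - 1) a w) y * G $ word_index k y)"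
      by (rule tensor_power_mult_index[OF M(1) r k0 G insert_at_in_words[OF t' a w]])
    also have "\<dots> = (\<Sum>j<k. \<Sum>y\<in>words k (n - 1). kernel_product M (insert_at (t - 1) a w) (insert_at (t - 1) j y) * g j y)"
      unfolding g_def by (rule sum_insert_at[OF t'])
    also have "\<dots> = (\<Sum>j<k. M $$ (a, j) * h j w)"
      unfolding h_def sum_distrib_left
    proof (intro sum.cong refl)
      fix j y assume "y \<in> words k (n - 1)"
      then have "length w = length y" using w by (simp add: words_def)
      then show "kernel_product M (insert_at (t - 1) a w) (insert_at (t - 1) j y) * g j y =
          M $$ (a, j) * (kernel_product M w y * g j y)"
        by (simp add: kernel_product_insert_at)
    qed
    finally show ?thesis ..
  qed
  have "words r (n - 1) \<noteq> {}" using index_word_in_words[OF r] by blast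
  then obtain p q where pq: "p \<in> words r (n - 1)" "q \<in> words r (n - 1)"
    and gen: "\<And>w. w \<in> words r (n - 1) \<Longrightarrow> \<exists>a b. V1 w = a * V1 p + b * V1 q \<and> V2 w = a * V2 p + b * V2 q"
    using two_dimensional_generators[of "words r (n - 1)" V1 V2] by metis
  obtain x :: "nat \<Rightarrow> complex" and j0 where x: "j0 < k" "x j0 \<noteq> 0" "(\<Sum>j<k. x j * h j p) = 0" "(\<Sum>j<k. x j * h j q) = 0"
    by (rule two_equations_nontrivial_solution[OF k])
  have xh: "(\<Sum>j<k. x j * h j w) = 0" if w: "w \<in> words r (n - 1)" for w
  proof -
    obtain a b where ab: "V1 w = a * V1 p + b * V1 q" "V2 w = a * V2 p + b * V2 q" using gen[OF w] by blast
    have "h j w - a * h j p - b * h j q = 0" if "j < k" for j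
    proof (rule injM[of "\<lambda>j. h j w - a * h j p - b * h j q", OF _ that])
      fix i assume i: "i < r"
      have "(\<Sum>j<k. M $$ (i, j) * (h j w - a * h j p - b * h j q)) =
          (\<Sum>j<k. M $$ (i, j) * h j w) - a * (\<Sum>j<k. M $$ (i, j) * h j p) - b * (\<Sum>j<k. M $$ (i, j) * h j q)"
        by (simp add: sum_subtractf sum_distrib_left algebra_simps)
      then show "(\<Sum>j<k. M $$ (i, j) * (h j w - a * h j p - b * h j q)) = 0"
        unfolding dec[OF i w] dec[OF i pq(1)] dec[OF i pq(2)] ab by (simp add: algebra_simps)
    qed
    then have "h j w = a * h j p + b * h j q" if "j < k" for j using that by (simp add: algebra_simps)
    then have "(\<Sum>j<k. x j * h j w) = (\<Sum>j<k. a * (x j * h j p) + b * (x j * h j q))"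
      by (intro sum.cong) (simp_all add: algebra_simps)
    then show ?thesis by (simp add: sum.distrib sum_distrib_left[symmetric] x)
  qed
  \<comment> \<open>Removes the other \<open>n - 1\<close> factors \<open>M\<close>, after which the
    relation concerns the rows of \<open>flattening k n t G\<close> itself.\<close>
  have xg: "(\<Sum>j<k. x j * g j y) = 0" if y: "y \<in> words k (n - 1)" for y
  proof (rule kernel_product_injective[where r = r and M = M and g = "\<lambda>y. \<Sum>j<k. x j * g j y", OF _ _ y])
    show "h j = 0" if "\<And>a. a < r \<Longrightarrow> (\<Sum>j<k. M $$ (a, j) * h j) = 0" "j < k" for h j
      by (rule injM[OF that])
  next
    fix w assume "w \<in> words r (n - 1)"
    then have "0 = (\<Sum>j<k. x j * h j w)" using xh by simp
    also have "\<dots> = (\<Sum>y\<in>words k (n - 1). \<Sum>j<k. x j * (kernel_product M w y * g j y))"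
      unfolding h_def sum_distrib_left by (rule sum.swap)
    finally show "(\<Sum>y\<in>words k (n - 1). kernel_product M w y * (\<Sum>j<k. x j * g j y)) = 0"
      by (simp add: sum_distrib_left mult.left_commute)
  qed
  have F: "flattening k n t G \<in> carrier_mat k (k ^ (n - 1))" by (simp add: flattening_def)
  have "x j0 = 0"
  proof (rule full_row_rank_injective[OF F rF _ x(1)])
    fix c assume c: "c < k ^ (n - 1)"
    have "flattening k n t G $$ (j, c) = g j (index_word k (n - 1) c)" if "j < k" for j
      using that c by (simp add: flattening_def Let_def g_def insert_at_def)
    then show "(\<Sum>j<k. x j * flattening k n t G $$ (j, c)) = 0"
      using xg[OF index_word_in_words[OF k0]] by simp
  qed
  then show False using x by simp
qed

section \<open>Nonsingular submatrices\<close>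

lemma two_by_two_kernel:
  fixes a b c d :: "'a :: field"
  assumes "a * d \<noteq> b * c" "a * x + b * y = 0" "c * x + d * y = 0"
  shows "x = 0" "y = 0"
proof -
  have "(a * d - b * c) * x = d * (a * x + b * y) - b * (c * x + d * y)" by (simp add: algebra_simps)
  then show "x = 0" using assms by simp
  have "(a * d - b * c) * y = a * (c * x + d * y) - c * (a * x + b * y)" by (simp add: algebra_simps)
  then show "y = 0" using assms by simp
qed

text \<open>\<open>submatrix\<close> keeps the natural order of rows and columns, so the two blocks
  may be interleaved in it. A trivial kernel is shown instead of computing a determinant: the zero
  entries split the four equations into two nonsingular systems, whatever the order.\<close>

lemma block_submatrix_rank_4:
  fixes A :: "complex Matrix.mat"
  assumes A: "A \<in> carrier_mat nr nc"
    and r: "r1 < nr" "r2 < nr" "r3 < nr" "r4 < nr" and c: "c1 < nc" "c2 < nc" "c3 < nc" "c4 < nc"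
    and m: "A $$ (r1, c1) * A $$ (r2, c2) \<noteq> A $$ (r1, c2) * A $$ (r2, c1)"
      "A $$ (r3, c3) * A $$ (r4, c4) \<noteq> A $$ (r3, c4) * A $$ (r4, c3)"
    and z: "A $$ (r1, c3) = 0" "A $$ (r1, c4) = 0" "A $$ (r2, c3) = 0" "A $$ (r2, c4) = 0"
      "A $$ (r3, c1) = 0" "A $$ (r3, c2) = 0" "A $$ (r4, c1) = 0" "A $$ (r4, c2) = 0"
  shows "\<exists>I J. I \<subseteq> {..<nr} \<and> card I = 4 \<and> J \<subseteq> {..<nc} \<and> card J = 4 \<and>
    vec_space.rank 4 (submatrix A I J) = 4"
proof (intro exI conjI)
  let ?I = "{r1, r2, r3, r4}" and ?J = "{c1, c2, c3, c4}"
  \<comment> \<open>Equal rows or columns within a pair make its minor zero, and equal ones across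
    the pairs put zeros into a minor.\<close>
  have dr: "r1 \<noteq> r2" "r1 \<noteq> r3" "r1 \<noteq> r4" "r2 \<noteq> r3" "r2 \<noteq> r4" "r3 \<noteq> r4"
    and dc: "c1 \<noteq> c2" "c1 \<noteq> c3" "c1 \<noteq> c4" "c2 \<noteq> c3" "c2 \<noteq> c4" "c3 \<noteq> c4"
    using m z by (auto simp: mult.commute)
  show I: "?I \<subseteq> {..<nr}" and J: "?J \<subseteq> {..<nc}" using r c by auto
  show cI: "card ?I = 4" and cJ: "card ?J = 4" using dr dc by simp_all
  define S where "S = submatrix A ?I ?J"
  have "{i. i < dim_row A \<and> i \<in> ?I} = ?I" "{j. j < dim_col A \<and> j \<in> ?J} = ?J" using A I J by auto
  then have S: "S \<in> carrier_mat 4 4" unfolding S_def using dim_submatrix[of A ?I ?J] cI cJ by (intro carrier_matI) simp_all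
  have "det S \<noteq> 0"
  proof
    assume "det S = 0"
    then obtain v where v: "v \<in> carrier_vec 4" "v \<noteq> 0\<^sub>v 4" "S *\<^sub>v v = 0\<^sub>v 4"
      using det_0_iff_vec_prod_zero_field[OF S] by blast
    let ?pos = "\<lambda>X x. card {a \<in> X. a < (x::nat)}"
    \<comment> \<open>The coordinate of \<open>v\<close> at the place that column \<open>x\<close>
      takes in \<open>S\<close>; it frees the equations from the order of the columns.\<close>
    define y where "y x = v $ ?pos ?J x" for x
    have pos: "?pos X x < 4" if "x \<in> X" "card X = 4" for X x
    proof -
      have "finite X" using that by (metis card.infinite zero_neq_numeral)
      moreover have "{a \<in> X. a < x} \<subset> X" using that by blast
      ultimately show ?thesis using psubset_card_mono that by metis
    qed
    have eq: "(\<Sum>x\<in>?J. A $$ (r, x) * y x) = 0" if rI: "r \<in> ?I" for r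
    proof -
      have "(S *\<^sub>v v) $ ?pos ?I r = (\<Sum>q<4. S $$ (?pos ?I r, q) * v $ q)"
        using S v(1) pos[OF rI cI] by (simp add: scalar_prod_def lessThan_atLeast0)
      also have "\<dots> = (\<Sum>x\<in>?J. A $$ (r, x) * y x)"
      proof (rule sum.reindex_bij_witness[of _ "?pos ?J" "pick ?J"])
        fix q :: nat assume "q \<in> {..<4}"
        then have q: "q < card ?J" using cJ by simp
        show "?pos ?J (pick ?J q) = q" using card_pick[of q ?J] q by simp
        show pJ: "pick ?J q \<in> ?J" by (rule pick_in_set) (use q in simp)
        show "A $$ (r, pick ?J q) * y (pick ?J q) = S $$ (?pos ?I r, q) * v $ q"
        proof -
          have "r < dim_row A" "pick ?J q < dim_col A" using subsetD[OF I rI] subsetD[OF J pJ] A by simp_all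
          then have "S $$ (?pos ?I r, ?pos ?J (pick ?J q)) = A $$ (r, pick ?J q)"
            unfolding S_def using rI pJ by (rule submatrix_index_card)
          then show ?thesis unfolding y_def \<open>?pos ?J (pick ?J q) = q\<close> by simp
        qed
      next
        fix x assume x: "x \<in> ?J"
        show "pick ?J (?pos ?J x) = x" using pick_card_in_set[OF x] .
        show "?pos ?J x \<in> {..<4}" using pos[OF x cJ] by simp
      qed
      finally show ?thesis using v(3) pos[OF rI cI] by simp
    qed
    have J4: "(\<Sum>x\<in>?J. f x) = f c1 + f c2 + f c3 + f c4" for f :: "nat \<Rightarrow> complex"
      using dc by (simp add: add.assoc)
    have "A $$ (r1, c1) * y c1 + A $$ (r1, c2) * y c2 = 0" "A $$ (r2, c1) * y c1 + A $$ (r2, c2) * y c2 = 0"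
      "A $$ (r3, c3) * y c3 + A $$ (r3, c4) * y c4 = 0" "A $$ (r4, c3) * y c3 + A $$ (r4, c4) * y c4 = 0"
      using eq[of r1] eq[of r2] eq[of r3] eq[of r4] unfolding J4 by (simp_all add: z)
    then have "y c1 = 0" "y c2 = 0" "y c3 = 0" "y c4 = 0"
      using two_by_two_kernel[OF m(1)] two_by_two_kernel[OF m(2)] by blast+
    then have y0: "y x = 0" if "x \<in> ?J" for x using that by blast
    have "v = 0\<^sub>v 4"
    proof (rule eq_vecI)
      fix q assume "q < dim_vec (0\<^sub>v 4 :: complex Matrix.vec)"
      then have q: "q < card ?J" "q < 4" using cJ by simp_all
      have "?pos ?J (pick ?J q) = q" using card_pick[of q ?J] q by simp
      moreover have "pick ?J q \<in> ?J" by (rule pick_in_set) (use q in simp)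
      ultimately have "v $ q = 0" using y0[of "pick ?J q"] unfolding y_def by metis
      then show "v $ q = 0\<^sub>v 4 $ q" using q by simp
    qed (use v in simp)
    then show False using v by blast
  qed
  then show "vec_space.rank 4 (submatrix A ?I ?J) = 4"
    using vec_space.det_rank_iff[OF S] unfolding S_def by simp
qed

section \<open>Label sets of the rows and columns of the flattening\<close>

definition ones :: "nat list \<Rightarrow> nat set" where
  "ones bs = {s. s < length bs \<and> bs ! s = 1}"

lemma ones_append: "ones (P @ Q) = ones P \<union> (+) (length P) ` ones Q"
proof (intro subset_antisym subsetI)
  fix s assume s: "s \<in> ones (P @ Q)"
  show "s \<in> ones P \<union> (+) (length P) ` ones Q"
  proof (cases "s < length P")
    case False
    then have "s - length P \<in> ones Q" "s = length P + (s - length P)"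
      using s by (auto simp: ones_def nth_append)
    then show ?thesis by blast
  qed (use s in \<open>auto simp: ones_def nth_append\<close>)
qed (auto simp: ones_def nth_append)

text \<open>One letter over \<open>b ^ l\<close> occupies \<open>l\<close> digits in base
  \<open>b\<close>, so inserting it at place \<open>i\<close> inserts \<open>l\<close> digits at
  place \<open>i * l\<close>.\<close>

lemma index_word_insert_at_blocks:
  assumes i: "i < n" and \<alpha>: "\<alpha> < b ^ l" and b: "b > 0" and c: "c < b ^ ((n - 1) * l)"
  defines "w \<equiv> index_word (b ^ l) (n - 1) c" and "B \<equiv> index_word b ((n - 1) * l) c"
  shows "index_word b (n * l) (word_index (b ^ l) (insert_at i \<alpha> w)) = take (i * l) B @ index_word b l \<alpha> @ drop (i * l) B"
proof -
  have w: "w \<in> words (b ^ l) (n - 1)" unfolding w_def using b by (intro index_word_in_words) simp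
  have c': "c < (b ^ l) ^ (n - 1)" using c by (simp add: power_mult[symmetric] mult.commute)
  have "index_word b ((n - 1) * l) (word_index (b ^ l) w) = concat (map (index_word b l) w)"
    by (rule index_word_blocks[OF b w])
  then have B: "B = concat (map (index_word b l) w)"
    unfolding B_def w_def using b c' by (simp add: word_index_index_word)
  have "B = concat (map (index_word b l) (take i w @ drop i w))" unfolding B by simp
  then have "B = concat (map (index_word b l) (take i w)) @ concat (map (index_word b l) (drop i w))"
    by (simp only: map_append concat_append)
  moreover have "length (concat (map (index_word b l) (take i w))) = i * l"
    using w i by (simp add: length_concat comp_def sum_list_triv words_def)
  ultimately have "take (i * l) B = concat (map (index_word b l) (take i w))"
    "drop (i * l) B = concat (map (index_word b l) (drop i w))" by simp_all
  then show ?thesis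
    using index_word_blocks[OF b insert_at_in_words[OF i \<alpha> w]] by (simp add: insert_at_def)
qed

definition row_labels :: "nat \<Rightarrow> nat \<Rightarrow> nat \<Rightarrow> nat set" where
  "row_labels q l \<alpha> = (+) q ` ones (index_word 2 l \<alpha>)"

text \<open>The bits of a column index skip the block of the row: those before \<open>q\<close> keep
  their place, the later ones move up by \<open>l\<close>.\<close>

definition column_labels :: "nat \<Rightarrow> nat \<Rightarrow> nat \<Rightarrow> nat \<Rightarrow> nat set" where
  "column_labels q l N c = ones (take q (index_word 2 N c)) \<union> (+) (q + l) ` ones (drop q (index_word 2 N c))"

lemma row_labels_subset: "row_labels q l \<alpha> \<subseteq> {q..<q + l}"
  by (auto simp: row_labels_def ones_def)

lemma column_labels_subset: "q \<le> N \<Longrightarrow> column_labels q l N c \<subseteq> {..<N + l} - {q..<q + l}"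
  by (auto simp: column_labels_def ones_def)

lemma bits_word:
  obtains x where "x < 2 ^ N" "index_word 2 N x = map (\<lambda>s. of_bool (P s)) [0..<N]"
proof -
  have "map (\<lambda>s. of_bool (P s)) [0..<N] \<in> words 2 N" by (auto simp: words_def)
  then show thesis using that[of "word_index 2 (map (\<lambda>s. of_bool (P s)) [0..<N])"] word_index_of_word[of 2] by simp
qed

text \<open>Together with its analogue for columns, this finds matrix indices for the label sets
  that \<open>nonvanishing_minor_pair\<close> delivers.\<close>

lemma row_labels_surj:
  assumes "R \<subseteq> {q..<q + l}"
  obtains \<alpha> where "\<alpha> < 2 ^ l" "row_labels q l \<alpha> = R"
proof -
  obtain \<alpha> where \<alpha>: "\<alpha> < 2 ^ l" "index_word 2 l \<alpha> = map (\<lambda>s. of_bool (q + s \<in> R)) [0..<l]"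
    by (rule bits_word)
  have "ones (index_word 2 l \<alpha>) = {s. s < l \<and> q + s \<in> R}" unfolding \<alpha>(2) by (auto simp: ones_def of_bool_def split: if_splits)
  then have "row_labels q l \<alpha> = (+) q ` {s. s < l \<and> q + s \<in> R}" by (simp add: row_labels_def)
  also have "\<dots> = R"
  proof (intro subset_antisym subsetI)
    fix x assume "x \<in> R"
    moreover have "q \<le> x" "x < q + l" using subsetD[OF assms \<open>x \<in> R\<close>] by simp_all
    ultimately have "x = q + (x - q)" "x - q \<in> {s. s < l \<and> q + s \<in> R}" by auto
    then show "x \<in> (+) q ` {s. s < l \<and> q + s \<in> R}" by blast
  qed auto
  finally show thesis using that \<alpha>(1) by blast
qed

lemma column_labels_surj:
  assumes C: "C \<subseteq> {..<N + l} - {q..<q + l}" and q: "q \<le> N"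
  obtains c where "c < 2 ^ N" "column_labels q l N c = C"
proof -
  obtain c where c: "c < 2 ^ N" "index_word 2 N c = map (\<lambda>s. of_bool ((if s < q then s else s + l) \<in> C)) [0..<N]"
    by (rule bits_word)
  have "ones (take q (index_word 2 N c)) = {s. s < q \<and> s \<in> C}"
    unfolding c(2) using q by (auto simp: ones_def of_bool_def split: if_splits)
  moreover have "ones (drop q (index_word 2 N c)) = {s. s < N - q \<and> q + l + s \<in> C}"
    unfolding c(2) using q by (auto simp: ones_def of_bool_def ac_simps split: if_splits)
  ultimately have "column_labels q l N c = {s. s < q \<and> s \<in> C} \<union> (+) (q + l) ` {s. s < N - q \<and> q + l + s \<in> C}"
    by (simp add: column_labels_def)
  also have "\<dots> = C"
  proof (intro subset_antisym subsetI)
    fix x assume x: "x \<in> C"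
    show "x \<in> {s. s < q \<and> s \<in> C} \<union> (+) (q + l) ` {s. s < N - q \<and> q + l + s \<in> C}"
    proof (cases "x < q")
      case False
      then have "x \<ge> q + l" "x < N + l" using x C by auto
      then have "x = q + l + (x - (q + l))" "x - (q + l) \<in> {s. s < N - q \<and> q + l + s \<in> C}" using x by auto
      then show ?thesis by blast
    qed (use x in auto)
  qed auto
  finally show thesis using that c(1) by blast
qed

text \<open>The bridge from matrix entries to deleted outputs: the ones of the assembled binary word
  are the row labels inside the block and the column labels outside it.\<close>

lemma (in drawn_gate) flattening_signature_entry:
  assumes len: "length (outputs H) = n * l" and t: "t \<in> {1..n}"
    and \<alpha>: "\<alpha> < 2 ^ l" and x: "x < 2 ^ ((n - 1) * l)"
  shows "flattening (2 ^ l) n t (standard_signature H) $$ (\<alpha>, x) =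
    sig (row_labels ((t - 1) * l) l \<alpha> \<union> column_labels ((t - 1) * l) l ((n - 1) * l) x)"
proof -
  let ?q = "(t - 1) * l" and ?B = "index_word 2 ((n - 1) * l) x"
  let ?W = "insert_at (t - 1) \<alpha> (index_word (2 ^ l) (n - 1) x)"
  let ?y = "word_index (2 ^ l) ?W"
  have t': "t - 1 < n" using t by auto
  have x': "x < (2 ^ l) ^ (n - 1)" using x by (simp add: power_mult[symmetric] mult.commute)
  have qle: "?q \<le> (n - 1) * l" using t by (intro mult_le_mono1) auto
  have "?W \<in> words (2 ^ l) n" by (intro insert_at_in_words t' \<alpha> index_word_in_words) simp
  then have "?y < (2 ^ l) ^ n" using word_index_of_word[of "2 ^ l" ?W n] by simp
  then have y: "?y < 2 ^ (n * l)" by (simp add: power_mult[symmetric] mult.commute)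
  have bits: "index_word 2 (n * l) ?y = take ?q ?B @ index_word 2 l \<alpha> @ drop ?q ?B"
    using index_word_insert_at_blocks[OF t' \<alpha> _ x] by simp
  have "length (take ?q ?B) = ?q" using qle by simp
  then have "ones (index_word 2 (n * l) ?y) = row_labels ?q l \<alpha> \<union> column_labels ?q l ((n - 1) * l) x"
    unfolding bits ones_append row_labels_def column_labels_def by (auto simp: image_Un image_image add.assoc)
  moreover have "{outputs H ! s | s. s < n * l \<and> index_word 2 (n * l) ?y ! s = 1} = out ` ones (index_word 2 (n * l) ?y)"
    by (auto simp: ones_def out_def)
  moreover have "flattening (2 ^ l) n t (standard_signature H) $$ (\<alpha>, x) = standard_signature H $ ?y"
    using \<alpha> x' by (simp add: flattening_def Let_def insert_at_def)
  moreover have "standard_signature H $ ?y =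
      perf_match (delete_nodes H {outputs H ! s | s. s < n * l \<and> index_word 2 (n * l) ?y ! s = 1})"
    using y by (simp add: standard_signature_def Let_def len)
  ultimately show ?thesis by (simp add: sig_def)
qed

theorem theorem5p1:
  fixes k n l t :: nat
    and G G' :: "complex Matrix.vec"
    and M :: "complex Matrix.mat"
    and H :: "'v gate"
  assumes "k \<ge> 3" and "n \<ge> 1" and "l \<ge> 1"
    and "G \<in> carrier_vec (k ^ n)"
    and "full_rank k n G"
    and "t \<in> {1..n}" and "vec_space.rank k (flattening k n t G) = k"
    and "M \<in> carrier_mat (2 ^ l) k" and "vec_space.rank (2 ^ l) M = k"
    and "G' = tensor_power n M *\<^sub>v G"
    and "generator_matchgate (n * l) H" and "G' = standard_signature H"
  shows "\<exists>I J. I \<subseteq> {..<2 ^ l} \<and> card I = 4 \<and> J \<subseteq> {..<2 ^ ((n - 1) * l)} \<and> card J = 4 \<and>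
    vec_space.rank 4 (submatrix (flattening (2 ^ l) n t G') I J) = 4"
proof -
  obtain p c where "drawn_gate H p c" and len: "length (outputs H) = n * l"
    using assms(11) unfolding generator_matchgate_def by (blast intro: drawn_gate.intro)
  then interpret drawn_gate H p c by blast
  define N q where "N = (n - 1) * l" and "q = (t - 1) * l"
  define S where "S = {q..<q + l}"
  \<comment> \<open>\<open>n \<ge> 1\<close> makes the truncated difference \<open>n - 1\<close>
    exact.\<close>
  have Nl: "N + l = n * l" using assms(2) by (simp add: N_def algebra_simps flip: mult_Suc)
  have qN: "q \<le> N" unfolding q_def N_def using assms(6) by (intro mult_le_mono1) auto
  have labels: "labels = {..<N + l}" by (simp add: labels_def len Nl)
  have blk: "order_block labels S" unfolding order_block_def S_def labels using qN by auto
  have SU: "S \<subseteq> labels" using blk by (simp add: order_block_def)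
  have pw: "(2 ^ l) ^ (n - 1) = (2 :: nat) ^ N" by (simp add: N_def power_mult[symmetric] mult.commute)
  define F where "F = flattening (2 ^ l) n t G'"
  have F: "F \<in> carrier_mat (2 ^ l) (2 ^ N)" unfolding F_def flattening_def pw by simp
  have entry: "F $$ (\<alpha>, c) = sig (row_labels q l \<alpha> \<union> column_labels q l N c)" if "\<alpha> < 2 ^ l" "c < 2 ^ N" for \<alpha> c
    unfolding F_def assms(12) q_def N_def
    by (rule flattening_signature_entry[OF len assms(6) that(1) that(2)[unfolded N_def]])
  have ns: "\<not> small_minors_vanish labels S sig"
  proof
    assume "small_minors_vanish labels S sig"
    then have "even_minors_vanish labels S sig N" for N
      by (rule even_minors_vanish[OF finite_labels blk sig_matchgate_identities])
    then obtain u1 v1 u2 v2 where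
      uv: "\<And>\<alpha> \<beta>. \<alpha> \<subseteq> S \<Longrightarrow> \<beta> \<subseteq> labels - S \<Longrightarrow> sig (\<alpha> \<union> \<beta>) = u1 \<alpha> * v1 \<beta> + u2 \<alpha> * v2 \<beta>"
      using signature_rank_le_2[OF finite_labels SU _ sig_parity_supported] by metis
    have "F $$ (\<alpha>, c) = u1 (row_labels q l \<alpha>) * v1 (column_labels q l N c) +
        u2 (row_labels q l \<alpha>) * v2 (column_labels q l N c)"
      if "\<alpha> < 2 ^ l" "c < (2 ^ l) ^ (n - 1)" for \<alpha> c
      using entry that uv[of "row_labels q l \<alpha>" "column_labels q l N c"] row_labels_subset column_labels_subset[OF qN]
      unfolding pw labels S_def by simp
    then have "\<exists>u1 v1 u2 v2. \<forall>a<2 ^ l. \<forall>c<(2 ^ l) ^ (n - 1). F $$ (a, c) = u1 a * v1 c + u2 a * v2 c"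
      by (intro exI allI impI)
    then show False
      using flattening_not_rank_le_2[OF assms(1,2) _ assms(4,6,7,8,9)] unfolding F_def assms(10) by simp
  qed
  obtain r1 r2 r3 r4 c1 c2 c3 c4 where
    rc: "r1 \<subseteq> S" "r2 \<subseteq> S" "r3 \<subseteq> S" "r4 \<subseteq> S"
      "c1 \<subseteq> labels - S" "c2 \<subseteq> labels - S" "c3 \<subseteq> labels - S" "c4 \<subseteq> labels - S"
    and minors: "sig (r1 \<union> c1) * sig (r2 \<union> c2) \<noteq> sig (r1 \<union> c2) * sig (r2 \<union> c1)"
      "sig (r3 \<union> c3) * sig (r4 \<union> c4) \<noteq> sig (r3 \<union> c4) * sig (r4 \<union> c3)"
    and zeros: "sig (r1 \<union> c3) = 0" "sig (r1 \<union> c4) = 0" "sig (r2 \<union> c3) = 0" "sig (r2 \<union> c4) = 0"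
      "sig (r3 \<union> c1) = 0" "sig (r3 \<union> c2) = 0" "sig (r4 \<union> c1) = 0" "sig (r4 \<union> c2) = 0"
    by (rule nonvanishing_minor_pair[OF finite_labels sig_matchgate_identities blk sig_parity_supported ns])
  \<comment> \<open>Every set of labels inside the block belongs to a row index. Distinctness of the
    indices obtained is left to \<open>block_submatrix_rank_4\<close>, which derives it from the
    minors and zeros.\<close>
  have row: "\<exists>\<alpha><2 ^ l. row_labels q l \<alpha> = R" if "R \<subseteq> S" for R
    using row_labels_surj[of R q l] that unfolding S_def by metis
  have column: "\<exists>c<2 ^ N. column_labels q l N c = C" if "C \<subseteq> labels - S" for C
    using column_labels_surj[OF _ qN, of C l] that unfolding S_def labels by metis
  obtain \<alpha>1 \<alpha>2 \<alpha>3 \<alpha>4 where \<alpha>: "\<alpha>1 < 2 ^ l" "\<alpha>2 < 2 ^ l" "\<alpha>3 < 2 ^ l" "\<alpha>4 < 2 ^ l"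
    "row_labels q l \<alpha>1 = r1" "row_labels q l \<alpha>2 = r2" "row_labels q l \<alpha>3 = r3" "row_labels q l \<alpha>4 = r4"
    using row[OF rc(1)] row[OF rc(2)] row[OF rc(3)] row[OF rc(4)] by blast
  obtain x1 x2 x3 x4 where x: "x1 < 2 ^ N" "x2 < 2 ^ N" "x3 < 2 ^ N" "x4 < 2 ^ N"
    "column_labels q l N x1 = c1" "column_labels q l N x2 = c2" "column_labels q l N x3 = c3" "column_labels q l N x4 = c4"
    using column[OF rc(5)] column[OF rc(6)] column[OF rc(7)] column[OF rc(8)] by blast
  have "\<exists>I J. I \<subseteq> {..<2 ^ l} \<and> card I = 4 \<and> J \<subseteq> {..<2 ^ N} \<and> card J = 4 \<and>
    vec_space.rank 4 (submatrix F I J) = 4"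
    by (rule block_submatrix_rank_4[OF F \<alpha>(1-4) x(1-4)]) (simp_all add: entry \<alpha> x minors zeros)
  then show ?thesis by (simp add: F_def N_def)
qed

end
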